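(* Let $\mathcal{F}$ be the smallest family of finite posets that contains every $X$-free finite poset and that is closed under the two operations $(\mathcal{P},\mathcal{Q}) \mapsto \mathcal{P} < \mathcal{Q}$ and $(\mathcal{P},\mathcal{Q}) \mapsto \mathcal{P} \sqcup \mathcal{Q}$ (applied to posets on disjoint ground sets). Then for every poset $\mathcal{P} \in \mathcal{F}$, $$f_{\mathcal{O}(\mathcal{P})} \le f_{\mathcal{C}(\mathcal{P})},$$ that is, for every $i$ the number of $i$-dimensional faces of the order polytope $\mathcal{O}(\mathcal{P})$ is at most the number of $i$-dimensional faces of the chain polytope $\mathcal{C}(\mathcal{P})$.
   Context: All posets are finite. For a finite poset $\mathcal{P}$, the order polytope $\mathcal{O}(\mathcal{P}) \subseteq \mathbb{R}^{\mathcal{P}}$ is defined by $0 \le x_i \le 1$ for all $i \in \mathcal{P}$ and $x_i \le x_j$ for all $i \le j$ in $\mathcal{P}$. The chain polytope $\mathcal{C}(\mathcal{P}) \subseteq \mathbb{R}^{\mathcal{P}}$ is defined by $x_i \ge 0$ for all $i \in \mathcal{P}$ and $\sum_{i \in C} x_i \le 1$ for every chain $C$ of $\mathcal{P}$. For posets $A,B$ on disjoint sets, the ordinal sum $A<B$ is the poset on $A \cup B$ with $x \le y$ iff $x \le y$ in $A$, or $x\le y$ in $B$, or $x \in A$ and $y \in B$; the disjoint union $A \sqcup B$ is the poset on $A\cup B$ with $x \le y$ iff $x \le y$ in $A$ or $x \le y$ in $B$. The $X$-poset is the 5-element poset with elements $a,b,c,d,e$ whose cover relations are $a<c$, $b<c$,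 $c<d$, $c<e$ (two minimal elements below a middle element, which is below two maximal elements). A poset is $X$-free if it has no induced subposet isomorphic to the $X$-poset. For a polytope $P$ of dimension $d$, its $f$-polynomial is $f_P = \sum_{i=-1}^{d} f_i x^{i+1}$, where $f_i$ is the number of $i$-dimensional faces of $P$ (the empty face has dimension $-1$ and $P$ itself counts as a face). For polynomials $f,g$ with nonnegative integer coefficients, $f \le g$ means that every coefficient of $f$ is at most the corresponding coefficient of $g$. *)

theory Defs
  imports "HOL-Analysis.Analysis" "HOL-Computational_Algebra.Polynomial"
begin

text \<open>A finite poset is a finite ground set \<open>A\<close> together with its (reflexive) order relation
  \<open>r \<subseteq> A \<times> A\<close>, satisfying \<open>partial_order_on A r\<close>.\<close>

definition ordinal_sum :: "'a set \<Rightarrow> 'a rel \<Rightarrow> 'a set \<Rightarrow> 'a rel \<Rightarrow> 'a rel" where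
  "ordinal_sum A r B s = r \<union> s \<union> A \<times> B"

definition poset_isomorphic :: "'a set \<Rightarrow> 'a rel \<Rightarrow> 'b set \<Rightarrow> 'b rel \<Rightarrow> bool" where
  "poset_isomorphic A r B s \<longleftrightarrow>
     (\<exists>h. bij_betw h A B \<and> (\<forall>x\<in>A. \<forall>y\<in>A. (x, y) \<in> r \<longleftrightarrow> (h x, h y) \<in> s))"

datatype X_elem = Xa | Xb | Xc | Xd | Xe

definition X_order :: "X_elem rel" where
  "X_order = {(Xa, Xc), (Xb, Xc), (Xc, Xd), (Xc, Xe)}\<^sup>*"

definition X_free :: "'a set \<Rightarrow> 'a rel \<Rightarrow> bool" where
  "X_free A r \<longleftrightarrow>
     \<not> (\<exists>S\<subseteq>A. poset_isomorphic S (r \<inter> S \<times> S) (UNIV :: X_elem set) X_order)"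

text \<open>The ground sets of the two arguments of either operation are subsets of the ground set of
  the result, so the family may be generated inside the type of the final ground set.\<close>

inductive X_family :: "'a set \<Rightarrow> 'a rel \<Rightarrow> bool" where
  X_free: "finite A \<Longrightarrow> partial_order_on A r \<Longrightarrow> X_free A r \<Longrightarrow> X_family A r"
| ordinal_sum: "X_family A r \<Longrightarrow> X_family B s \<Longrightarrow> A \<inter> B = {} \<Longrightarrow>
    X_family (A \<union> B) (ordinal_sum A r B s)"
| disjoint_union: "X_family A r \<Longrightarrow> X_family B s \<Longrightarrow> A \<inter> B = {} \<Longrightarrow>
    X_family (A \<union> B) (r \<union> s)"

text \<open>For \<open>A\<close> a set of elements of a finite type \<open>'a\<close>, the space of real vectors indexed by \<open>A\<close> is
  realised as the coordinate subspace of \<open>real ^ 'a\<close> on which the coordinates outside \<open>A\<close> vanish.\<close>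

definition order_polytope :: "'a::finite set \<Rightarrow> 'a rel \<Rightarrow> (real ^ 'a) set" where
  "order_polytope A r =
     {x. (\<forall>i. i \<notin> A \<longrightarrow> x $ i = 0) \<and>
         (\<forall>i\<in>A. 0 \<le> x $ i \<and> x $ i \<le> 1) \<and>
         (\<forall>i j. (i, j) \<in> r \<longrightarrow> x $ i \<le> x $ j)}"

definition chain_polytope :: "'a::finite set \<Rightarrow> 'a rel \<Rightarrow> (real ^ 'a) set" where
  "chain_polytope A r =
     {x. (\<forall>i. i \<notin> A \<longrightarrow> x $ i = 0) \<and>
         (\<forall>i\<in>A. 0 \<le> x $ i) \<and>
         (\<forall>C\<in>Chains r. (\<Sum>i\<in>C. x $ i) \<le> 1)}"

definition face_number :: "'v::euclidean_space set \<Rightarrow> int \<Rightarrow> nat" where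
  "face_number P i = card {F. F face_of P \<and> aff_dim F = i}"

definition f_polynomial :: "'v::euclidean_space set \<Rightarrow> nat poly" where
  "f_polynomial P = (\<Sum>i = -1..aff_dim P. monom (face_number P i) (nat (i + 1)))"

definition coeffwise_le :: "nat poly \<Rightarrow> nat poly \<Rightarrow> bool" where
  "coeffwise_le f g \<longleftrightarrow> (\<forall>k. coeff f k \<le> coeff g k)"

lemma coeff_f_polynomial: "coeff (f_polynomial P) k = face_number P (int k - 1)"
proof -
  have "coeff (f_polynomial P) k =
      (\<Sum>i = -1..aff_dim P. if i = int k - 1 then face_number P i else 0)"
    unfolding f_polynomial_def coeff_sum by (intro sum.cong refl) auto
  also have "\<dots> = (if int k - 1 \<le> aff_dim P then face_number P (int k - 1) else 0)"
    by (simp add: sum.delta)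
  also have "\<dots> = face_number P (int k - 1)"
  proof (cases "int k - 1 \<le> aff_dim P")
    case False
    have "aff_dim F \<noteq> int k - 1" if "F face_of P" for F
      using False aff_dim_subset[OF face_of_imp_subset[OF that]] by linarith
    then have "{F. F face_of P \<and> aff_dim F = int k - 1} = {}" by blast
    then have "face_number P (int k - 1) = 0" unfolding face_number_def by (metis card.empty)
    then show ?thesis using False by simp
  qed simp
  finally show ?thesis .
qed

lemma partial_order_on_ordinal_sum:
  assumes "partial_order_on A r" "partial_order_on B s" "A \<inter> B = {}"
  shows "partial_order_on (A \<union> B) (ordinal_sum A r B s)"
proof -
  have r: "r \<subseteq> A \<times> A" "refl_on A r" "trans r" "antisym r"
    and s: "s \<subseteq> B \<times> B" "refl_on B s" "trans s" "antisym s"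
    using assms unfolding partial_order_on_def preorder_on_def by auto
  have "ordinal_sum A r B s \<subseteq> (A \<union> B) \<times> (A \<union> B)"
    using r(1) s(1) unfolding ordinal_sum_def by blast
  moreover have "refl_on (A \<union> B) (ordinal_sum A r B s)"
    using r(2) s(2) unfolding ordinal_sum_def refl_on_def by blast
  moreover have "trans (ordinal_sum A r B s)"
  proof (rule transI)
    fix x y z assume "(x, y) \<in> ordinal_sum A r B s" "(y, z) \<in> ordinal_sum A r B s"
    then show "(x, z) \<in> ordinal_sum A r B s"
      using r(1) s(1) assms(3) transD[OF r(3), of x y z] transD[OF s(3), of x y z]
      unfolding ordinal_sum_def by blast
  qed
  moreover have "antisym (ordinal_sum A r B s)"
  proof (rule antisymI)
    fix x y assume "(x, y) \<in> ordinal_sum A r B s" "(y, x) \<in> ordinal_sum A r B s"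
    then show "x = y"
      using r(1) s(1) assms(3) antisymD[OF r(4), of x y] antisymD[OF s(4), of x y]
      unfolding ordinal_sum_def by blast
  qed
  ultimately show ?thesis unfolding partial_order_on_def preorder_on_def by blast
qed

lemma partial_order_on_disjoint_union:
  assumes "partial_order_on A r" "partial_order_on B s" "A \<inter> B = {}"
  shows "partial_order_on (A \<union> B) (r \<union> s)"
proof -
  have r: "r \<subseteq> A \<times> A" "refl_on A r" "trans r" "antisym r"
    and s: "s \<subseteq> B \<times> B" "refl_on B s" "trans s" "antisym s"
    using assms unfolding partial_order_on_def preorder_on_def by auto
  have "r \<union> s \<subseteq> (A \<union> B) \<times> (A \<union> B)"
    using r(1) s(1) by blast
  moreover have "refl_on (A \<union> B) (r \<union> s)"
    using r(2) s(2) unfolding refl_on_def by blast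
  moreover have "trans (r \<union> s)"
  proof (rule transI)
    fix x y z assume "(x, y) \<in> r \<union> s" "(y, z) \<in> r \<union> s"
    then show "(x, z) \<in> r \<union> s"
      using r(1) s(1) assms(3) transD[OF r(3), of x y z] transD[OF s(3), of x y z] by blast
  qed
  moreover have "antisym (r \<union> s)"
  proof (rule antisymI)
    fix x y assume "(x, y) \<in> r \<union> s" "(y, x) \<in> r \<union> s"
    then show "x = y"
      using r(1) s(1) assms(3) antisymD[OF r(4), of x y] antisymD[OF s(4), of x y] by blast
  qed
  ultimately show ?thesis unfolding partial_order_on_def preorder_on_def by blast
qed

lemma X_family_poset: "X_family A r \<Longrightarrow> finite A \<and> partial_order_on A r"
  by (induction rule: X_family.induct)
    (simp_all add: partial_order_on_ordinal_sum partial_order_on_disjoint_union)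

lemma polytope_if_bounded_coordinates:
  fixes P :: "(real ^ 'a::finite) set"
  assumes "polyhedron P" and "\<And>x i. x \<in> P \<Longrightarrow> 0 \<le> x $ i \<and> x $ i \<le> 1"
  shows "polytope P"
proof -
  have "P \<subseteq> cbox 0 (\<chi> i. 1)"
    using assms(2) by (auto simp: mem_box_cart)
  then show ?thesis
    using assms(1) bounded_cbox bounded_subset polytope_eq_bounded_polyhedron by blast
qed

lemma polytope_order_polytope: "polytope (order_polytope A r)"
proof (rule polytope_if_bounded_coordinates)
  have eq: "order_polytope A r =
      \<Inter> ((\<lambda>i. {x. axis i 1 \<bullet> x = 0}) ` (- A)
       \<union> (\<lambda>i. {x. axis i 1 \<bullet> x \<ge> 0}) ` A \<union> (\<lambda>i. {x. axis i 1 \<bullet> x \<le> 1}) ` A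
       \<union> (\<lambda>(i, j). {x. (axis i 1 - axis j 1) \<bullet> x \<le> 0}) ` r)"
    unfolding order_polytope_def
    by (auto simp: inner_axis' inner_diff_left)
  show "polyhedron (order_polytope A r)" unfolding eq
    by (intro polyhedron_Inter)
      (auto intro: polyhedron_halfspace_le polyhedron_halfspace_ge polyhedron_hyperplane)
  show "\<And>x i. x \<in> order_polytope A r \<Longrightarrow> 0 \<le> x $ i \<and> x $ i \<le> 1"
    unfolding order_polytope_def using zero_le_one order_refl by (smt (verit) mem_Collect_eq)
qed

lemma polytope_chain_polytope:
  assumes "partial_order_on A r"
  shows "polytope (chain_polytope A r)"
proof (rule polytope_if_bounded_coordinates)
  have eq: "chain_polytope A r =
      \<Inter> ((\<lambda>i. {x. axis i 1 \<bullet> x = 0}) ` (- A) \<union> (\<lambda>i. {x. axis i 1 \<bullet> x \<ge> 0}) ` A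
       \<union> (\<lambda>C. {x. (\<Sum>i\<in>C. axis i 1) \<bullet> x \<le> 1}) ` Chains r)"
    unfolding chain_polytope_def
    by (auto simp: inner_axis' inner_sum_left)
  show "polyhedron (chain_polytope A r)" unfolding eq
    by (intro polyhedron_Inter)
      (auto intro: polyhedron_halfspace_le polyhedron_halfspace_ge polyhedron_hyperplane)
  fix x i assume x: "x \<in> chain_polytope A r"
  show "0 \<le> x $ i \<and> x $ i \<le> 1"
  proof (cases "i \<in> A")
    case True
    then have "{i} \<in> Chains r"
      using assms by (auto simp: Chains_def partial_order_on_def preorder_on_def refl_on_def)
    then have "(\<Sum>j\<in>{i}. x $ j) \<le> 1" using x unfolding chain_polytope_def by blast
    then show ?thesis using x True unfolding chain_polytope_def by auto
  qed (use x in \<open>auto simp: chain_polytope_def\<close>)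
qed

end

theory Submission
  imports Defs
begin

text \<open>
  For an X-free poset the elements below \<open>c\<close> or the elements above \<open>c\<close> form a chain, for every \<open>c\<close>, and
  taking differences along these chains is an affine isomorphism from the order polytope onto the
  chain polytope. Disjoint unions of posets give products of polytopes.

  For ordinal sums, grade the faces of a polytope containing the origin by their linear dimension, and
  let \<open>a\<close> and \<open>b\<close> be the generating functions of the faces through and off the origin, so that the
  \<open>f\<close>-polynomial is \<open>x a + b\<close>. Both polytopes of an ordinal sum are, up to affine isomorphism, the
  convex hull of the union of the two given polytopes placed in complementary subspaces (for order
  polytopes the upper one reversed), and there both \<open>a\<close> and \<open>b\<close> are multiplicative. Choosing for each
  face through the origin a facet off the origin shows \<open>a \<le> b\<close>. The origin is a simple vertex of the
  chain polytope, so \<open>a\<close> is as small as the dimension permits there. With \<open>\<alpha>\<close>, \<open>\<beta>\<close> denoting \<open>a\<close>, \<open>b\<close> for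
  the chain polytopes, the inequality follows from
  \<open>(x \<alpha> \<alpha>' + \<beta> \<beta>') - (x a a' + b b') = x (a - \<alpha>) (b' - a') + (x \<alpha> + \<beta> - x a - b) b'
    + x (a' - \<alpha>') (\<beta> - \<alpha>) + \<beta> (x \<alpha>' + \<beta>' - x a' - b')\<close>,
  where every factor on the right has nonnegative coefficients.
\<close>

section \<open>Faces under affine isomorphisms and products\<close>

lemma affine_map_segment:
  assumes "linear (\<lambda>x. f x - f 0)"
  shows "f ((1 - u) *\<^sub>R x + u *\<^sub>R y) = (1 - u) *\<^sub>R f x + u *\<^sub>R f y"
proof -
  have "f ((1 - u) *\<^sub>R x + u *\<^sub>R y) - f 0 = (1 - u) *\<^sub>R (f x - f 0) + u *\<^sub>R (f y - f 0)"
    using linear_add[OF assms] linear_scale[OF assms] by simp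
  then show ?thesis by (simp add: algebra_simps)
qed

lemma aff_dim_affine_image_le:
  fixes f :: "'a::euclidean_space \<Rightarrow> 'b::euclidean_space"
  assumes "linear (\<lambda>x. f x - f 0)"
  shows "aff_dim (f ` F) \<le> aff_dim F"
proof -
  have "f ` F = (+) (f 0) ` (\<lambda>x. f x - f 0) ` F" by (auto simp: image_image)
  then show ?thesis
    using aff_dim_linear_image_le[OF assms, of F] by (simp add: aff_dim_translation_eq)
qed

text \<open>The maps are mutually inverse only between \<open>S\<close> and \<open>T\<close>, not on
  the ambient spaces, whose dimensions may differ. Affine maps never raise the dimension, so using
  this for \<open>f\<close> and for \<open>g\<close> gives equality; open segments pull back along
  \<open>g\<close> because \<open>g\<close> is injective on \<open>T\<close>.\<close>

lemma affine_iso_face: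
  fixes f :: "'a::euclidean_space \<Rightarrow> 'b::euclidean_space"
  assumes f: "linear (\<lambda>x. f x - f 0)" and g: "linear (\<lambda>x. g x - g 0)"
    and "f ` S \<subseteq> T" "g ` T \<subseteq> S" "\<And>x. x \<in> S \<Longrightarrow> g (f x) = x" "\<And>y. y \<in> T \<Longrightarrow> f (g y) = y"
    and F: "F face_of S"
  shows "f ` F face_of T" and "aff_dim (f ` F) = aff_dim F" and "g ` f ` F = F"
proof -
  have sub: "F \<subseteq> S" using F by (rule face_of_imp_subset)
  show gf: "g ` f ` F = F"
    using assms(5) sub by (force simp: image_image)
  show "aff_dim (f ` F) = aff_dim F"
    using aff_dim_affine_image_le[OF f, of F] aff_dim_affine_image_le[OF g, of "f ` F"] gf
    by simp
  have "f ` F = (+) (f 0) ` (\<lambda>x. f x - f 0) ` F" by (auto simp: image_image)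
  then have "convex (f ` F)"
    using convex_linear_image[OF f] convex_translation face_of_imp_convex[OF F] by metis
  moreover have "a \<in> f ` F \<and> b \<in> f ` F"
    if ab: "a \<in> T" "b \<in> T" and x: "x \<in> F" and seg: "f x \<in> open_segment a b" for a b x
  proof -
    obtain u where u: "0 < u" "u < 1" "f x = (1 - u) *\<^sub>R a + u *\<^sub>R b" "a \<noteq> b"
      using seg by (auto simp: in_segment)
    have "x = (1 - u) *\<^sub>R g a + u *\<^sub>R g b"
      using affine_map_segment[OF g] u(3) assms(5) x sub by (metis subsetD)
    moreover have "g a \<noteq> g b" using u(4) assms(6) ab by metis
    ultimately have "x \<in> open_segment (g a) (g b)"
      using u by (auto simp: in_segment)
    then have "g a \<in> F \<and> g b \<in> F"
      using face_ofD[OF F] x assms(4) ab by blast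
    then show ?thesis using assms(6) ab by (metis image_eqI)
  qed
  ultimately show "f ` F face_of T"
    unfolding face_of_def using sub assms(3) by blast
qed

lemma face_number_affine_iso:
  fixes f :: "'a::euclidean_space \<Rightarrow> 'b::euclidean_space"
  assumes f: "linear (\<lambda>x. f x - f 0)" and g: "linear (\<lambda>x. g x - g 0)"
    and fS: "f ` S \<subseteq> T" and gT: "g ` T \<subseteq> S"
    and gf: "\<And>x. x \<in> S \<Longrightarrow> g (f x) = x" and fg: "\<And>y. y \<in> T \<Longrightarrow> f (g y) = y"
  shows "face_number S i = face_number T i"
proof -
  note 1 = affine_iso_face[OF f g fS gT gf fg]
  note 2 = affine_iso_face[OF g f gT fS fg gf]
  have "bij_betw ((`) f) {F. F face_of S \<and> aff_dim F = i} {F. F face_of T \<and> aff_dim F = i}"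
    by (rule bij_betwI[where g = "(`) g"]) (use 1 2 in auto)
  then show ?thesis unfolding face_number_def by (rule bij_betw_same_card)
qed

section \<open>Faces of products\<close>

text \<open>The convolution behind two product formulas: for cartesian products and for convex hulls
  in complementary subspaces.\<close>

lemma card_pairs_graded:
  fixes d :: "'a \<Rightarrow> nat" and e :: "'b \<Rightarrow> nat"
  assumes "finite X" "finite Y"
  shows "card {(p, q). p \<in> X \<and> q \<in> Y \<and> d p + e q = k} =
    (\<Sum>j = 0..k. card {p \<in> X. d p = j} * card {q \<in> Y. e q = k - j})"
proof -
  have "{(p, q). p \<in> X \<and> q \<in> Y \<and> d p + e q = k} =
      (\<Union>j\<in>{0..k}. {p \<in> X. d p = j} \<times> {q \<in> Y. e q = k - j})"
    by auto
  also have "card \<dots> = (\<Sum>j = 0..k. card ({p \<in> X. d p = j} \<times> {q \<in> Y. e q = k - j}))"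
    using assms by (intro card_UN_disjoint) auto
  finally show ?thesis by (simp add: card_cartesian_product)
qed

lemma dim_union_axes:
  fixes F :: "'a::euclidean_space set" and G :: "'b::euclidean_space set"
  shows "dim (F \<times> {0} \<union> {0} \<times> G) = dim F + dim G"
proof -
  let ?U = "F \<times> {0} \<union> {0} \<times> G"
  have 1: "span F \<times> {0} \<subseteq> span ?U"
  proof -
    have "(\<lambda>x. (x, 0)) ` span F = span ((\<lambda>x. (x, 0::'b)) ` F)"
      by (rule linear_span_image[symmetric]) (auto intro: linearI)
    also have "\<dots> \<subseteq> span ?U" by (intro span_mono) auto
    finally show ?thesis by auto
  qed
  have 2: "{0} \<times> span G \<subseteq> span ?U"
  proof -
    have "(\<lambda>x. (0, x)) ` span G = span ((\<lambda>x. (0::'a, x)) ` G)"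
      by (rule linear_span_image[symmetric]) (auto intro: linearI)
    also have "\<dots> \<subseteq> span ?U" by (intro span_mono) auto
    finally show ?thesis by auto
  qed
  have "span F \<times> span G \<subseteq> span ?U"
  proof clarify
    fix x y assume "x \<in> span F" "y \<in> span G"
    then have "(x, 0) + (0, y) \<in> span ?U" using 1 2 by (intro span_add) auto
    then show "(x, y) \<in> span ?U" by simp
  qed
  moreover have "span ?U \<subseteq> span F \<times> span G"
    by (intro span_minimal subspace_Times) (auto intro: span_base span_0)
  ultimately have "span ?U = span F \<times> span G" by blast
  then show ?thesis
    by (metis dim_Times dim_span subspace_span)
qed

text \<open>Translation reduces this to sets containing the origin, where affine dimension is linear
  dimension. An empty factor is excluded because its affine dimension is -1, which in general breaks
  additivity.\<close>

lemma aff_dim_Times_nonempty: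
  fixes F :: "'a::euclidean_space set" and G :: "'b::euclidean_space set"
  assumes "F \<noteq> {}" "G \<noteq> {}"
  shows "aff_dim (F \<times> G) = aff_dim F + aff_dim G"
proof -
  have zero: "aff_dim (F \<times> G) = aff_dim F + aff_dim G"
    if 0: "0 \<in> F" "0 \<in> G" for F :: "'a set" and G :: "'b set"
  proof -
    have "F \<times> G \<subseteq> span (F \<times> {0} \<union> {0} \<times> G)"
    proof clarify
      fix x y assume "x \<in> F" "y \<in> G"
      then have "(x, 0) + (0, y) \<in> span (F \<times> {0} \<union> {0} \<times> G)"
        by (intro span_add span_base) auto
      then show "(x, y) \<in> span (F \<times> {0} \<union> {0} \<times> G)" by simp
    qed
    moreover have "F \<times> {0} \<union> {0} \<times> G \<subseteq> F \<times> G" using 0 by auto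
    ultimately have "dim (F \<times> G) = dim F + dim G"
      by (metis dim_union_axes dim_span dim_subset order_antisym)
    then show ?thesis using 0 by (simp add: aff_dim_zero hull_inc zero_prod_def)
  qed
  obtain a b where ab: "a \<in> F" "b \<in> G" using assms by blast
  have "(+) (- (a, b)) ` (F \<times> G) = ((+) (- a) ` F) \<times> ((+) (- b) ` G)"
    by (force simp: image_iff)
  then have "aff_dim (F \<times> G) = aff_dim (((+) (- a) ` F) \<times> ((+) (- b) ` G))"
    by (metis aff_dim_translation_eq)
  also have "\<dots> = aff_dim ((+) (- a) ` F) + aff_dim ((+) (- b) ` G)"
    using ab by (intro zero) (force simp: image_iff)+
  finally show ?thesis by (simp only: aff_dim_translation_eq)
qed

lemma aff_dim_nonneg_if_nonempty: "F \<noteq> {} \<Longrightarrow> 0 \<le> aff_dim F"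
  by (metis aff_dim_negative_iff not_le)

text \<open>\<open>nat\<close> sends the dimension -1 of the empty face to 0, so nonemptiness is
  stated separately to keep that face out of the count of vertices.\<close>

lemma face_number_eq_nonempty:
  "face_number S (int k) = card {F. F face_of S \<and> F \<noteq> {} \<and> nat (aff_dim F) = k}"
proof -
  have "aff_dim F = int k \<longleftrightarrow> F \<noteq> {} \<and> nat (aff_dim F) = k" for F :: "'a set"
    using aff_dim_nonneg_if_nonempty[of F] by (cases "F = {}") auto
  then show ?thesis unfolding face_number_def by (metis (no_types))
qed

text \<open>Nonempty faces of the product correspond to pairs of nonempty faces, and nonemptiness
  makes the factors recoverable from their product. The empty face, of dimension -1, lies outside
  the indices \<open>int k\<close>.\<close>

lemma face_number_Times:
  fixes S :: "'a::euclidean_space set" and T :: "'b::euclidean_space set"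
  assumes S: "polytope S" and T: "polytope T"
  shows "face_number (S \<times> T) (int k) =
    (\<Sum>j = 0..k. face_number S (int j) * face_number T (int (k - j)))"
proof -
  let ?X = "{F. F face_of S \<and> F \<noteq> {}}" and ?Y = "{F. F face_of T \<and> F \<noteq> {}}"
  have fin: "finite ?X" "finite ?Y"
    using finite_polytope_faces[OF S] finite_polytope_faces[OF T]
    by (auto intro: finite_subset[rotated])
  have "{H. H face_of S \<times> T \<and> H \<noteq> {} \<and> nat (aff_dim H) = k} =
      (\<lambda>(F, G). F \<times> G) ` {(F, G). F \<in> ?X \<and> G \<in> ?Y \<and> nat (aff_dim F) + nat (aff_dim G) = k}"
    (is "?L = ?f ` ?R")
  proof (intro equalityI subsetI)
    fix H assume "H \<in> ?L"
    then obtain F G where "F face_of S" "G face_of T" "H = F \<times> G" "H \<noteq> {}" "nat (aff_dim H) = k"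
      by (auto simp: face_of_Times_decomp)
    then show "H \<in> ?f ` ?R"
      by (auto simp: aff_dim_Times_nonempty aff_dim_nonneg_if_nonempty nat_add_distrib
          intro!: image_eqI[of _ _ "(F, G)"])
  next
    fix H assume "H \<in> ?f ` ?R"
    then obtain F G where "F face_of S" "G face_of T" "F \<noteq> {}" "G \<noteq> {}" "H = F \<times> G"
        "nat (aff_dim F) + nat (aff_dim G) = k"
      by auto
    then show "H \<in> ?L"
      by (simp add: face_of_Times aff_dim_Times_nonempty aff_dim_nonneg_if_nonempty nat_add_distrib)
  qed
  moreover have "inj_on ?f ?R" by (auto simp: inj_on_def times_eq_iff)
  ultimately have "face_number (S \<times> T) (int k) = card ?R"
    by (simp add: face_number_eq_nonempty card_image)
  also have "\<dots> = (\<Sum>j = 0..k. card {F \<in> ?X. nat (aff_dim F) = j} * card {G \<in> ?Y. nat (aff_dim G) = k - j})"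
    by (rule card_pairs_graded[OF fin])
  finally show ?thesis by (simp add: face_number_eq_nonempty conj_assoc del: of_nat_diff)
qed

lemma face_number_minus_one: "face_number S (- 1) = 1"
proof -
  have "{F. F face_of S \<and> aff_dim F = - 1} = {{}}" by (auto simp: aff_dim_empty[symmetric])
  then show ?thesis unfolding face_number_def by simp
qed

section \<open>Faces through and off the origin\<close>

definition star_number :: "'v::euclidean_space set \<Rightarrow> nat \<Rightarrow> nat" where
  "star_number S k = card {F. F face_of S \<and> 0 \<in> F \<and> dim F = k}"

text \<open>The linear dimension of a face is the affine dimension of its join with the origin. The
  empty face counts here, in degree 0.\<close>

definition antistar_number :: "'v::euclidean_space set \<Rightarrow> nat \<Rightarrow> nat" where
  "antistar_number S k = card {F. F face_of S \<and> 0 \<notin> F \<and> dim F = k}"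

text \<open>A face is the intersection of \<open>S\<close> with the affine hull of the face, so the
  origin lies outside that hull and adjoining it raises the dimension by one. The empty face fits,
  with -1 = 0 - 1.\<close>

lemma aff_dim_face_off_zero:
  fixes S :: "'v::euclidean_space set"
  assumes "convex S" "0 \<in> S" "F face_of S" "0 \<notin> F"
  shows "aff_dim F = int (dim F) - 1"
proof -
  have "0 \<notin> affine hull F" using face_of_imp_eq_affine_Int[OF assms(1,3)] assms by blast
  then have "aff_dim (insert 0 F) = aff_dim F + 1" by (simp add: aff_dim_insert)
  moreover have "aff_dim (insert 0 F) = int (dim F)"
    by (simp add: aff_dim_zero hull_inc dim_insert span_0)
  ultimately show ?thesis by simp
qed

text \<open>Coefficient form of \<open>x a + b\<close>: a face of affine dimension
  \<open>k - 1\<close> has linear dimension \<open>k - 1\<close> if it passes through the origin and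
  \<open>k\<close> otherwise.\<close>

lemma face_number_star_antistar:
  fixes S :: "'v::euclidean_space set"
  assumes S: "polytope S" "0 \<in> S"
  shows "face_number S (int k - 1) =
    (if k = 0 then 0 else star_number S (k - 1)) + antistar_number S k"
proof -
  let ?X = "{F. F face_of S \<and> 0 \<in> F \<and> Suc (dim F) = k}"
  let ?Y = "{F. F face_of S \<and> 0 \<notin> F \<and> dim F = k}"
  have "aff_dim F = int k - 1 \<longleftrightarrow> F \<in> ?X \<union> ?Y" if "F face_of S" for F
    using aff_dim_face_off_zero[OF polytope_imp_convex[OF S(1)] S(2) that] that
    by (cases "0 \<in> F") (auto simp: aff_dim_zero hull_inc)
  then have "{F. F face_of S \<and> aff_dim F = int k - 1} = ?X \<union> ?Y" by blast
  moreover have "finite (?X \<union> ?Y)"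
    by (rule finite_subset[OF _ finite_polytope_faces[OF S(1)]]) auto
  ultimately have "face_number S (int k - 1) = card ?X + card ?Y"
    unfolding face_number_def by (simp add: card_Un_disjoint disjoint_iff)
  moreover have "card ?X = (if k = 0 then 0 else star_number S (k - 1))"
    by (cases k) (auto simp: star_number_def)
  ultimately show ?thesis unfolding antistar_number_def by simp
qed

text \<open>From a nonzero relative interior point \<open>x\<close>, the ray pointing away from the
  origin leaves \<open>F\<close> through some facet. If that facet contained the origin, it would
  contain \<open>x\<close> by convexity, which no proper face does.\<close>

lemma exists_facet_off_zero:
  fixes F :: "'v::euclidean_space set"
  assumes F: "polytope F" "0 \<in> F" "F \<noteq> {0}"
  shows "\<exists>G. G facet_of F \<and> 0 \<notin> G"
proof -
  have conv: "convex F" using F(1) by (rule polytope_imp_convex)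
  have "rel_interior F \<noteq> {0}"
  proof
    assume "rel_interior F = {0}"
    then have "closure F = closure {0}" using convex_closure_rel_interior[OF conv] by simp
    then show False using F(3) closed_singleton polytope_imp_closed[OF F(1)] by (metis closure_closed)
  qed
  moreover have "rel_interior F \<noteq> {}" using rel_interior_eq_empty[OF conv] F(2) by blast
  ultimately obtain x where x: "x \<in> rel_interior F" "x \<noteq> 0" by blast
  have xF: "x \<in> F" using x(1) rel_interior_subset by blast
  \<comment> \<open>Since the origin lies in \<open>F\<close>, the affine hull is a linear subspace,
    so the ray in direction \<open>x\<close> stays inside it.\<close>
  have "x + x \<in> affine hull F"
    using xF F(2) by (simp add: affine_hull_span_0 hull_inc span_add span_base)
  from ray_to_rel_frontier[OF polytope_imp_bounded[OF F(1)] x(1) this x(2)]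
  obtain d where d: "0 < d" "x + d *\<^sub>R x \<in> rel_frontier F" by metis
  then obtain G where G: "G facet_of F" "x + d *\<^sub>R x \<in> G"
    using rel_frontier_of_polyhedron[OF polytope_imp_polyhedron[OF F(1)]] by auto
  have "0 \<notin> G"
  proof
    assume "0 \<in> G"
    have "x = (1 - 1 / (1 + d)) *\<^sub>R 0 + (1 / (1 + d)) *\<^sub>R (x + d *\<^sub>R x)"
    proof -
      have "x + d *\<^sub>R x = (1 + d) *\<^sub>R x" by (simp add: scaleR_add_left)
      then show ?thesis using d(1) by simp
    qed
    then have "x \<in> G"
      using convexD_alt[OF face_of_imp_convex[OF facet_of_imp_face_of[OF G(1)]] \<open>0 \<in> G\<close> G(2), of "1 / (1 + d)"]
        d(1) by auto
    moreover have "G face_of F" "G \<noteq> F" using G(1) by (auto simp: facet_of_def)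
    ultimately show False
      using x(1) face_of_disjoint_rel_interior by blast
  qed
  then show ?thesis using G(1) by blast
qed

lemma aff_dim_Int_faces_lt:
  fixes S :: "'v::euclidean_space set"
  assumes "F face_of S" "F' face_of S" "\<not> F \<subseteq> F'"
  shows "aff_dim (F \<inter> F') < aff_dim F"
proof (rule face_of_aff_dim_lt)
  show "convex F" using assms(1) by (rule face_of_imp_convex)
  show "F \<inter> F' face_of F"
    using face_of_subset[OF face_of_Int[OF assms(1,2)] _ face_of_imp_subset[OF assms(1)]] by simp
  show "F \<inter> F' \<noteq> F" using assms(3) by blast
qed

text \<open>The choice of a facet preserves the degree: passing to a facet loses one affine
  dimension, and avoiding the origin makes the linear dimension exceed the affine one by
  one.\<close>

lemma star_le_antistar:
  fixes S :: "'v::euclidean_space set"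
  assumes S: "polytope S" "0 \<in> S"
  shows "star_number S k \<le> antistar_number S k"
proof -
  let ?X = "{F. F face_of S \<and> 0 \<in> F \<and> dim F = k}"
  let ?Y = "{F. F face_of S \<and> 0 \<notin> F \<and> dim F = k}"
  have conv: "convex S" using S(1) by (rule polytope_imp_convex)
  have "\<exists>G. G face_of F \<and> 0 \<notin> G \<and> dim G = dim F" if F: "F face_of S" "0 \<in> F" for F
  proof (cases "F = {0}")
    case True
    \<comment> \<open>The point \<open>{0}\<close> has no nonempty proper face; the empty face takes
      the place of its facet and has linear dimension 0 as well.\<close>
    then show ?thesis by (intro exI[of _ "{}"]) auto
  next
    case False
    obtain G where G: "G facet_of F" "0 \<notin> G"
      using exists_facet_off_zero[OF face_of_polytope_polytope[OF S(1) F(1)] F(2) False] by blast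
    have "aff_dim G = int (dim G) - 1"
      using G F aff_dim_face_off_zero face_of_imp_convex facet_of_imp_face_of by blast
    moreover have "aff_dim G = int (dim F) - 1"
      using G(1) F(2) by (simp add: facet_of_def aff_dim_zero hull_inc)
    ultimately have "dim G = dim F" by simp
    then show ?thesis using G facet_of_imp_face_of by blast
  qed
  then obtain g where g: "\<And>F. F face_of S \<Longrightarrow> 0 \<in> F \<Longrightarrow> g F face_of F \<and> 0 \<notin> g F \<and> dim (g F) = dim F"
    by metis
  \<comment> \<open>\<open>F\<close> is recovered from its facet as the smallest face containing the facet and the origin.\<close>
  have sub: "F \<subseteq> F'" if F: "F \<in> ?X" "F' \<in> ?X" "g F = g F'" for F F'
  proof (rule ccontr)
    assume "\<not> F \<subseteq> F'"
    then have "aff_dim (F \<inter> F') < aff_dim F" using aff_dim_Int_faces_lt[of F S F'] F by simp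
    then have "dim (F \<inter> F') < dim F" using F by (simp add: aff_dim_zero hull_inc)
    moreover have "g F face_of F" "g F face_of F'" using g[of F] g[of F'] F by auto
    then have "g F \<subseteq> F \<inter> F'" using face_of_imp_subset by (metis le_inf_iff)
    then have "dim (g F) \<le> dim (F \<inter> F')" by (rule dim_subset)
    ultimately show False using g F by auto
  qed
  have "inj_on g ?X"
  proof (rule inj_onI)
    fix F F' assume "F \<in> ?X" "F' \<in> ?X" "g F = g F'"
    then show "F = F'" using sub[of F F'] sub[of F' F] by auto
  qed
  moreover have "g ` ?X \<subseteq> ?Y" using g face_of_trans by auto
  moreover have "finite ?Y"
    by (rule finite_subset[OF _ finite_polytope_faces[OF S(1)]]) auto
  ultimately show ?thesis unfolding star_number_def antistar_number_def by (rule card_inj_on_le)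
qed

section \<open>A lower bound for intervals of the face lattice\<close>

text \<open>Induction on the codimension of \<open>E\<close>: a proper face lies in a facet
  \<open>G\<close>, and either \<open>E = G\<close> and \<open>F\<close> itself covers
  \<open>E\<close>, or the search continues inside \<open>G\<close>.\<close>

lemma exists_covering_face:
  fixes F :: "'v::euclidean_space set"
  assumes "polytope F" "E face_of F" "E \<noteq> {}" "E \<noteq> F"
  shows "\<exists>E'. E' face_of F \<and> E \<subseteq> E' \<and> aff_dim E' = aff_dim E + 1"
  using assms
proof (induction "nat (aff_dim F - aff_dim E)" arbitrary: F rule: less_induct)
  case less
  obtain G where G: "G facet_of F" "E \<subseteq> G"
    using face_of_polyhedron_subset_facet[OF polytope_imp_polyhedron less.prems(2,3,4)] less.prems(1) by metis
  have GF: "G face_of F" "aff_dim G = aff_dim F - 1" using G(1) by (auto simp: facet_of_def)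
  show ?case
  proof (cases "E = G")
    case True
    then have "F face_of F \<and> E \<subseteq> F \<and> aff_dim F = aff_dim E + 1"
      using GF less.prems face_of_refl[OF polytope_imp_convex[OF less.prems(1)]] face_of_imp_subset[OF less.prems(2)]
      by simp
    then show ?thesis by blast
  next
    case False
    have pG: "polytope G" using less.prems(1) GF(1) face_of_polytope_polytope by blast
    have EG: "E face_of G" using face_of_subset[OF less.prems(2) G(2) face_of_imp_subset[OF GF(1)]] .
    then have "aff_dim E < aff_dim G" using False by (intro face_of_aff_dim_lt polytope_imp_convex[OF pG])
    then obtain E' where "E' face_of G \<and> E \<subseteq> E' \<and> aff_dim E' = aff_dim E + 1"
      using less.hyps[of G] pG EG False less.prems(3) GF(2) by auto
    then show ?thesis using GF(1) face_of_trans by blast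
  qed
qed

text \<open>An interval of the face lattice has at least as many elements of each rank as the
  Boolean lattice of the same length. The induction follows Pascal's rule: fix \<open>E'\<close>
  covering \<open>E\<close> and separate the faces containing \<open>E'\<close> from the
  others.\<close>

lemma face_interval_card_ge:
  fixes F :: "'v::euclidean_space set"
  assumes "polytope F" "E face_of F" "E \<noteq> {}" "aff_dim F = aff_dim E + int n"
  shows "n choose k \<le> card {H. H face_of F \<and> E \<subseteq> H \<and> aff_dim H = aff_dim E + int k}"
  using assms
proof (induction n arbitrary: E k)
  case 0
  show ?case
  proof (cases k)
    case 0
    have "E \<in> {H. H face_of F \<and> E \<subseteq> H \<and> aff_dim H = aff_dim E + int k}"
      using "0.prems" 0 by simp
    moreover have "finite {H. H face_of F \<and> E \<subseteq> H \<and> aff_dim H = aff_dim E + int k}"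
      by (rule finite_subset[OF _ finite_polytope_faces[OF assms(1)]]) auto
    ultimately have "0 < card {H. H face_of F \<and> E \<subseteq> H \<and> aff_dim H = aff_dim E + int k}"
      using card_gt_0_iff by blast
    then show ?thesis using 0 by simp
  qed simp
next
  case (Suc n)
  have fin: "finite {H. H face_of F \<and> P H}" for P
    by (rule finite_subset[OF _ finite_polytope_faces[OF assms(1)]]) auto
  have "E \<noteq> F" using Suc.prems(4) by auto
  then obtain E' where E': "E' face_of F" "E \<subseteq> E'" "aff_dim E' = aff_dim E + 1"
    using exists_covering_face Suc.prems by blast
  have E'ne: "E' \<noteq> {}" using E'(2) Suc.prems(3) by auto
  have IH: "n choose j \<le> card {H. H face_of F \<and> E' \<subseteq> H \<and> aff_dim H = aff_dim E' + int j}" for j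
    using Suc.IH[OF assms(1) E'(1) E'ne] E'(3) Suc.prems(4) by simp
  let ?A = "\<lambda>j. {H. H face_of F \<and> E' \<subseteq> H \<and> aff_dim H = aff_dim E + int j}"
  let ?B = "{H. H face_of F \<and> E \<subseteq> H \<and> \<not> E' \<subseteq> H \<and> aff_dim H = aff_dim E + int k}"
  \<comment> \<open>Each face of rank \<open>k + 1\<close> over \<open>E\<close> that contains
    \<open>E'\<close> is sent to a facet containing \<open>E\<close> but not \<open>E'\<close>; the
    induction hypothesis counts the former.\<close>
  have "n choose k \<le> card ?B"
  proof -
    have "\<exists>H. H facet_of H' \<and> E \<subseteq> H \<and> \<not> E' \<subseteq> H" if H': "H' face_of F" "E' \<subseteq> H'" for H'
    proof (rule ccontr)
      assume no: "\<not> ?thesis"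
      have "E face_of H'"
        using face_of_subset[OF Suc.prems(2) _ face_of_imp_subset[OF H'(1)]] E'(2) H'(2) by simp
      moreover have "E \<noteq> H'" using E' H'(2) by auto
      moreover have "polyhedron H'"
        using H'(1) assms(1) face_of_polytope_polytope polytope_imp_polyhedron by blast
      \<comment> \<open>A proper nonempty face is the intersection of the facets above it; if all of
        those contained \<open>E'\<close>, so would \<open>E\<close>.\<close>
      ultimately have "E = \<Inter>{H. H facet_of H' \<and> E \<subseteq> H}"
        using face_of_polyhedron Suc.prems(3) by blast
      then have "E' \<subseteq> E" using no by blast
      then show False using E' by auto
    qed
    then obtain g where g: "\<And>H'. H' face_of F \<Longrightarrow> E' \<subseteq> H' \<Longrightarrow> g H' facet_of H' \<and> E \<subseteq> g H' \<and> \<not> E' \<subseteq> g H'"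
      by metis
    \<comment> \<open>Otherwise \<open>H \<inter> H'\<close> would have a dimension strictly between
      those of the facet \<open>g H\<close> and of \<open>H\<close>.\<close>
    have sub: "H \<subseteq> H'" if H: "H face_of F" "E' \<subseteq> H" "H' face_of F" "E' \<subseteq> H'" "g H = g H'" for H H'
    proof (rule ccontr)
      assume "\<not> H \<subseteq> H'"
      then have 1: "aff_dim (H \<inter> H') < aff_dim H" using aff_dim_Int_faces_lt H by blast
      have gf: "g H facet_of H" "g H facet_of H'" using g H by metis+
      then have gs: "g H \<subseteq> H \<inter> H'" by (meson face_of_imp_subset facet_of_imp_face_of le_inf_iff)
      have "aff_dim (g H) < aff_dim (H \<inter> H')"
      proof (rule face_of_aff_dim_lt)
        show "convex (H \<inter> H')"
          using convex_Int face_of_imp_convex[OF H(1)] face_of_imp_convex[OF H(3)] by blast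
        show "g H face_of H \<inter> H'"
          using face_of_subset[OF facet_of_imp_face_of[OF gf(1)] gs] by simp
        have "\<not> E' \<subseteq> g H" using g H by metis
        then show "g H \<noteq> H \<inter> H'" using H by auto
      qed
      then show False using 1 gf(1) by (simp add: facet_of_def)
    qed
    have "inj_on g (?A (Suc k))"
    proof (rule inj_onI)
      fix H H' assume "H \<in> ?A (Suc k)" "H' \<in> ?A (Suc k)" "g H = g H'"
      then show "H = H'" using sub[of H H'] sub[of H' H] by auto
    qed
    moreover have "g ` ?A (Suc k) \<subseteq> ?B"
    proof clarify
      fix H assume H: "H face_of F" "E' \<subseteq> H" "aff_dim H = aff_dim E + int (Suc k)"
      then have "g H facet_of H" "E \<subseteq> g H" "\<not> E' \<subseteq> g H" using g by metis+
      moreover from this have "g H face_of F" using H(1) face_of_trans facet_of_imp_face_of by blast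
      ultimately show "g H face_of F \<and> E \<subseteq> g H \<and> \<not> E' \<subseteq> g H \<and> aff_dim (g H) = aff_dim E + int k"
        using H(3) by (simp add: facet_of_def)
    qed
    ultimately have "card (?A (Suc k)) \<le> card ?B" by (intro card_inj_on_le fin)
    then show ?thesis using IH[of k] E'(3) by (simp add: add_ac)
  qed
  moreover have "(if k = 0 then 0 else n choose (k - 1)) \<le> card (?A k)"
    using IH[of "k - 1"] E'(3) by auto
  moreover have "{H. H face_of F \<and> E \<subseteq> H \<and> aff_dim H = aff_dim E + int k} = ?A k \<union> ?B"
    using E'(2) by auto
  then have "card {H. H face_of F \<and> E \<subseteq> H \<and> aff_dim H = aff_dim E + int k} = card (?A k) + card ?B"
    using card_Un_disjoint[of "?A k" ?B] fin by (auto simp: disjoint_iff)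
  moreover have "Suc n choose k = (if k = 0 then 0 else n choose (k - 1)) + (n choose k)"
    by (cases k) auto
  ultimately show ?case by linarith
qed

lemma star_number_ge:
  fixes S :: "'v::euclidean_space set"
  assumes S: "polytope S" and z: "{0} face_of S"
  shows "dim S choose k \<le> star_number S k"
proof -
  have "0 \<in> S" using face_of_imp_subset[OF z] by simp
  then have "dim S choose k \<le> card {H. H face_of S \<and> {0} \<subseteq> H \<and> aff_dim H = aff_dim {0::'v} + int k}"
    using face_interval_card_ge[OF S z, of "dim S" k] by (simp add: aff_dim_zero hull_inc)
  also have "{H. H face_of S \<and> {0} \<subseteq> H \<and> aff_dim H = aff_dim {0::'v} + int k} =
      {F. F face_of S \<and> 0 \<in> F \<and> dim F = k}"
    by (auto simp: aff_dim_zero hull_inc)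
  finally show ?thesis unfolding star_number_def .
qed

section \<open>Sums of polytopes sharing a vertex\<close>

definition pointed_sum :: "'a::euclidean_space set \<Rightarrow> 'b::euclidean_space set \<Rightarrow> ('a \<times> 'b) set" where
  "pointed_sum S T = convex hull (S \<times> {0} \<union> {0} \<times> T)"

lemma pointed_sum_combination:
  assumes "x \<in> S" "y \<in> T" "0 \<le> u" "u \<le> 1"
  shows "(u *\<^sub>R x, (1 - u) *\<^sub>R y) \<in> pointed_sum S T"
proof -
  have "u *\<^sub>R (x, 0) + (1 - u) *\<^sub>R (0, y) \<in> pointed_sum S T"
    unfolding pointed_sum_def using assms
    by (intro convexD convex_convex_hull hull_inc) auto
  then show ?thesis by simp
qed

lemma pointed_sum_left: "x \<in> S \<Longrightarrow> (x, 0) \<in> pointed_sum S T"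
  unfolding pointed_sum_def by (rule hull_inc) auto

lemma pointed_sum_right: "y \<in> T \<Longrightarrow> (0, y) \<in> pointed_sum S T"
  unfolding pointed_sum_def by (rule hull_inc) auto

lemma pointed_sum_cases:
  assumes "convex S" "0 \<in> S" "convex T" "0 \<in> T" "z \<in> pointed_sum S T"
  obtains u x y where "0 \<le> u" "u \<le> 1" "x \<in> S" "y \<in> T" "z = (u *\<^sub>R x, (1 - u) *\<^sub>R y)"
proof -
  have "convex hull (S \<times> {0} \<union> {0} \<times> T) = {u *\<^sub>R s + v *\<^sub>R t | u v s t.
      u \<ge> 0 \<and> v \<ge> 0 \<and> u + v = 1 \<and> s \<in> S \<times> {0} \<and> t \<in> {0} \<times> T}"
    by (rule convex_hull_union_two) (use assms in \<open>auto intro: convex_Times\<close>)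
  then obtain u v s t where *: "z = u *\<^sub>R s + v *\<^sub>R t" "u \<ge> 0" "v \<ge> 0" "u + v = 1"
      "s \<in> S \<times> {0}" "t \<in> {0} \<times> T"
    using assms(5) unfolding pointed_sum_def by blast
  moreover have "v = 1 - u" using *(4) by simp
  ultimately show ?thesis using that[of u "fst s" "snd t"] by (cases s; cases t) auto
qed

text \<open>A point of the hull on an axis is a multiple, with factor between 0 and 1, of a point of
  the summand, so it lies on a segment from the origin inside that summand.\<close>

lemma pointed_sum_axes:
  assumes "convex S" "0 \<in> S" "convex T" "0 \<in> T"
  shows "(x, 0) \<in> pointed_sum S T \<longleftrightarrow> x \<in> S" "(0, y) \<in> pointed_sum S T \<longleftrightarrow> y \<in> T"
proof -
  show "(x, 0) \<in> pointed_sum S T \<longleftrightarrow> x \<in> S"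
  proof
    assume z: "(x, 0) \<in> pointed_sum S T"
    obtain u x' y' where "0 \<le> u" "u \<le> 1" "x' \<in> S" "y' \<in> T" "(x, 0) = (u *\<^sub>R x', (1 - u) *\<^sub>R y')"
      using pointed_sum_cases[OF assms z] .
    then show "x \<in> S" using convexD_alt[OF assms(1,2), of x' u] by simp
  qed (rule pointed_sum_left)
  show "(0, y) \<in> pointed_sum S T \<longleftrightarrow> y \<in> T"
  proof
    assume z: "(0, y) \<in> pointed_sum S T"
    obtain u x' y' where "0 \<le> u" "u \<le> 1" "x' \<in> S" "y' \<in> T" "(0, y) = (u *\<^sub>R x', (1 - u) *\<^sub>R y')"
      using pointed_sum_cases[OF assms z] .
    then show "y \<in> T" using convexD_alt[OF assms(3,4), of y' "1 - u"] by simp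
  qed (rule pointed_sum_right)
qed

lemma polytope_pointed_sum:
  assumes "polytope S" "polytope T"
  shows "polytope (pointed_sum S T)"
proof -
  obtain V W where VW: "finite V" "S = convex hull V" "finite W" "T = convex hull W"
    using assms unfolding polytope_def by blast
  have "S \<times> {0::'b} = convex hull (V \<times> {0})" "{0::'a} \<times> T = convex hull ({0} \<times> W)"
    unfolding VW by (simp_all add: convex_hull_Times)
  then have "pointed_sum S T = convex hull (V \<times> {0} \<union> {0} \<times> W)"
    unfolding pointed_sum_def by (simp add: hull_Un_left[symmetric] hull_Un_right[symmetric])
  then show ?thesis by (simp add: polytope_convex_hull VW(1,3))
qed

lemma dim_pointed_sum: "dim (pointed_sum F G) = dim F + dim G"
proof -
  have "pointed_sum F G \<subseteq> span (F \<times> {0} \<union> {0} \<times> G)"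
    unfolding pointed_sum_def by (intro hull_minimal span_superset) (simp add: subspace_imp_convex)
  moreover have "F \<times> {0} \<union> {0} \<times> G \<subseteq> pointed_sum F G"
    unfolding pointed_sum_def by (rule hull_subset)
  ultimately show ?thesis
    by (metis dim_union_axes dim_span dim_subset order_antisym)
qed

text \<open>Every face of a polytope is exposed, and as the origin lies in \<open>S\<close> the
  level of the functional is nonnegative. Normalizing it to 0 or 1 lets the functionals of two faces
  be combined at a common level.\<close>

lemma exposing_functional:
  fixes S :: "'v::euclidean_space set"
  assumes "polytope S" "0 \<in> S" "F face_of S" "b = (if 0 \<in> F then 0 else 1)"
  shows "\<exists>c. (\<forall>x\<in>S. c \<bullet> x \<le> b) \<and> (\<forall>x. x \<in> F \<longleftrightarrow> x \<in> S \<and> c \<bullet> x = b)"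
proof -
  have "F exposed_face_of S"
    using assms exposed_face_of_polyhedron polytope_imp_polyhedron by blast
  then obtain a b' where ab: "S \<subseteq> {x. a \<bullet> x \<le> b'}" "F = S \<inter> {x. a \<bullet> x = b'}"
    unfolding exposed_face_of_def by blast
  show ?thesis
  proof (cases "0 \<in> F")
    case True
    then have "b' = 0" using ab(2) by auto
    then show ?thesis using ab True assms(4) by (intro exI[of _ a]) auto
  next
    case False
    then have "b' > 0" using ab assms(2) by (auto simp: less_le)
    then show ?thesis using ab False assms(4) by (intro exI[of _ "a /\<^sub>R b'"]) (auto simp: field_simps)
  qed
qed

text \<open>By \<open>FG\<close> both functionals have the same level \<open>b\<close>, so
  \<open>(c, d)\<close> is at most \<open>b\<close> on the whole sum and exposes exactly the hull of
  the two faces.\<close>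

lemma pointed_sum_face:
  assumes S: "polytope S" "0 \<in> S" and T: "polytope T" "0 \<in> T"
    and F: "F face_of S" and G: "G face_of T" and FG: "0 \<in> F \<longleftrightarrow> 0 \<in> G"
  shows "pointed_sum F G face_of pointed_sum S T"
    and "{x. (x, 0) \<in> pointed_sum F G} = F" and "{y. (0, y) \<in> pointed_sum F G} = G"
proof -
  define b :: real where "b = (if 0 \<in> F then 0 else 1)"
  obtain c where c: "\<forall>x\<in>S. c \<bullet> x \<le> b" "\<forall>x. x \<in> F \<longleftrightarrow> x \<in> S \<and> c \<bullet> x = b"
    using exposing_functional[OF S F b_def] by blast
  obtain d where d: "\<forall>y\<in>T. d \<bullet> y \<le> b" "\<forall>y. y \<in> G \<longleftrightarrow> y \<in> T \<and> d \<bullet> y = b"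
    using exposing_functional[OF T G b_def[unfolded FG]] by blast
  have conv: "convex S" "convex T" using S T polytope_imp_convex by blast+
  note cases = pointed_sum_cases[OF conv(1) S(2) conv(2) T(2)]
  have le: "(c, d) \<bullet> z \<le> b" if z: "z \<in> pointed_sum S T" for z
  proof -
    obtain u x y where *: "0 \<le> u" "u \<le> 1" "x \<in> S" "y \<in> T" "z = (u *\<^sub>R x, (1 - u) *\<^sub>R y)"
      using cases[OF z] .
    have "u * (c \<bullet> x) + (1 - u) * (d \<bullet> y) \<le> u * b + (1 - u) * b"
      using * c(1) d(1) by (intro add_mono mult_left_mono) auto
    then show ?thesis using * by (simp add: inner_Pair algebra_simps)
  qed
  have eq: "pointed_sum F G = pointed_sum S T \<inter> {z. (c, d) \<bullet> z = b}"
  proof (intro equalityI subsetI)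
    fix z assume "z \<in> pointed_sum F G"
    moreover have "pointed_sum F G \<subseteq> pointed_sum S T"
      unfolding pointed_sum_def using face_of_imp_subset[OF F] face_of_imp_subset[OF G]
      by (intro hull_mono) auto
    moreover have "pointed_sum F G \<subseteq> {z. (c, d) \<bullet> z = b}"
      unfolding pointed_sum_def
      by (intro hull_minimal) (use c(2) d(2) in \<open>auto simp: convex_hyperplane\<close>)
    ultimately show "z \<in> pointed_sum S T \<inter> {z. (c, d) \<bullet> z = b}" by blast
  next
    fix z assume z: "z \<in> pointed_sum S T \<inter> {z. (c, d) \<bullet> z = b}"
    then obtain u x y where *: "0 \<le> u" "u \<le> 1" "x \<in> S" "y \<in> T" "z = (u *\<^sub>R x, (1 - u) *\<^sub>R y)"
      using cases[of z] by blast
    \<comment> \<open>Two nonnegative weighted slacks add up to zero, so both vanish; a slack can be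
      positive only where its weight is zero.\<close>
    have sum: "u * (b - c \<bullet> x) + (1 - u) * (b - d \<bullet> y) = 0"
      using z *(5) by (simp add: inner_Pair algebra_simps)
    have nn: "0 \<le> u * (b - c \<bullet> x)" "0 \<le> (1 - u) * (b - d \<bullet> y)"
      using * c(1) d(1) by (intro mult_nonneg_nonneg; simp)+
    then have "u * (b - c \<bullet> x) = 0" "(1 - u) * (b - d \<bullet> y) = 0" using sum by linarith+
    then have "u = 0 \<or> x \<in> F" "u = 1 \<or> y \<in> G" using * c(2) d(2) by auto
    then consider "u = 0" "y \<in> G" | "u = 1" "x \<in> F" | "x \<in> F" "y \<in> G" by fastforce
    then show "z \<in> pointed_sum F G"
      by cases (use * pointed_sum_combination pointed_sum_left pointed_sum_right in auto)
  qed
  show "pointed_sum F G face_of pointed_sum S T"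
    unfolding eq by (rule face_of_Int_supporting_hyperplane_le[OF _ le]) (simp add: pointed_sum_def)
  note axes = pointed_sum_axes[OF conv(1) S(2) conv(2) T(2)]
  show "{x. (x, 0) \<in> pointed_sum F G} = F" "{y. (0, y) \<in> pointed_sum F G} = G"
    unfolding eq using c(2) d(2) by (auto simp: axes)
qed

text \<open>A face is recovered from its traces \<open>F\<close> and \<open>G\<close> on the axes:
  each point of \<open>H\<close> lies on a segment from \<open>S \<times> {0}\<close> to
  \<open>{0} \<times> T\<close>, and a face meeting the interior of a segment contains its end
  points.\<close>

lemma face_of_pointed_sum:
  assumes S: "convex S" "0 \<in> S" and T: "convex T" "0 \<in> T" and H: "H face_of pointed_sum S T"
  defines "F \<equiv> {x. (x, 0) \<in> H}" and "G \<equiv> {y. (0, y) \<in> H}"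
  assumes FS: "F \<subseteq> S" and GT: "G \<subseteq> T"
  shows "F face_of S" "G face_of T" "H = pointed_sum F G" "0 \<in> F \<longleftrightarrow> 0 \<in> G" 
proof -
  have cH: "convex H" using H by (rule face_of_imp_convex)
  have "F = (\<lambda>x. (x, 0)) -` H" "G = (\<lambda>x. (0, x)) -` H" unfolding F_def G_def by auto
  then have cFG: "convex F" "convex G" 
    by (auto intro!: convex_linear_vimage cH linearI)
  show "F face_of S"
    unfolding face_of_def
  proof (intro conjI ballI impI)
    fix a b x assume "a \<in> S" "b \<in> S" "x \<in> F" "x \<in> open_segment a b"
    moreover from this have "(x, 0) \<in> open_segment (a, 0) (b, 0::'b)" by (auto simp: in_segment)
    ultimately show "a \<in> F" "b \<in> F"
      using face_ofD[OF H, of "(x, 0)" "(a, 0)" "(b, 0)"] by (auto simp: F_def pointed_sum_left)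
  qed (fact FS cFG)+
  show "G face_of T"
    unfolding face_of_def
  proof (intro conjI ballI impI)
    fix a b x assume "a \<in> T" "b \<in> T" "x \<in> G" "x \<in> open_segment a b"
    moreover from this have "(0, x) \<in> open_segment (0::'a, a) (0, b)" by (auto simp: in_segment)
    ultimately show "a \<in> G" "b \<in> G"
      using face_ofD[OF H, of "(0, x)" "(0, a)" "(0, b)"] by (auto simp: G_def pointed_sum_right)
  qed (fact GT cFG)+
  show "0 \<in> F \<longleftrightarrow> 0 \<in> G" unfolding F_def G_def by simp
  show "H = pointed_sum F G"
  proof
    show "pointed_sum F G \<subseteq> H"
      unfolding pointed_sum_def by (intro hull_minimal cH) (auto simp: F_def G_def)
    show "H \<subseteq> pointed_sum F G"
    proof
      fix z assume z: "z \<in> H"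
      then have "z \<in> pointed_sum S T" using face_of_imp_subset[OF H] by blast
      then obtain u x y where *: "0 \<le> u" "u \<le> 1" "x \<in> S" "y \<in> T" "z = (u *\<^sub>R x, (1 - u) *\<^sub>R y)"
        using pointed_sum_cases[OF S T] by blast
      consider "u = 0" | "u = 1" | "x = 0" "y = 0" | "0 < u" "u < 1" "(x, 0) \<noteq> (0, y)"
        using *(1,2) by fastforce
      then show "z \<in> pointed_sum F G"
      proof cases
        case 1
        then have "y \<in> G" using z * by (simp add: G_def)
        then show ?thesis using 1 * by (simp add: pointed_sum_right)
      next
        case 2
        then have "x \<in> F" using z * by (simp add: F_def)
        then show ?thesis using 2 * by (simp add: pointed_sum_left)
      next
        case 3
        then have "0 \<in> F" using z * by (simp add: F_def)
        then show ?thesis using 3 * pointed_sum_left[of 0 F G] by simp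
      next
        case 4
        have "z \<in> open_segment (0, y) (x, 0)"
          using 4 * by (auto simp: in_segment)
        then have "x \<in> F" "y \<in> G"
          using face_ofD[OF H, of z "(0, y)" "(x, 0)"] z * 
          by (auto simp: F_def G_def pointed_sum_left pointed_sum_right)
        then show ?thesis using * pointed_sum_combination by blast
      qed
    qed
  qed
qed

text \<open>Faces of the sum correspond to pairs of faces that both contain or both avoid the
  origin; \<open>p\<close> selects the case. The empty face is allowed in the second case, so no
  correction terms arise.\<close>

lemma card_faces_pointed_sum:
  assumes S: "polytope S" "0 \<in> S" and T: "polytope T" "0 \<in> T"
  shows "card {H. H face_of pointed_sum S T \<and> (0 \<in> H \<longleftrightarrow> p) \<and> dim H = k} =
    (\<Sum>j = 0..k. card {F. F face_of S \<and> (0 \<in> F \<longleftrightarrow> p) \<and> dim F = j} *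
      card {G. G face_of T \<and> (0 \<in> G \<longleftrightarrow> p) \<and> dim G = k - j})"
proof -
  let ?X = "{F. F face_of S \<and> (0 \<in> F \<longleftrightarrow> p)}" and ?Y = "{G. G face_of T \<and> (0 \<in> G \<longleftrightarrow> p)}"
  let ?R = "{(F, G). F \<in> ?X \<and> G \<in> ?Y \<and> dim F + dim G = k}"
  have fin: "finite ?X" "finite ?Y"
    using finite_polytope_faces[OF S(1)] finite_polytope_faces[OF T(1)]
    by (auto intro: finite_subset[rotated])
  have conv: "convex S" "convex T" using S T polytope_imp_convex by blast+
  have "bij_betw (\<lambda>(F, G). pointed_sum F G) ?R
      {H. H face_of pointed_sum S T \<and> (0 \<in> H \<longleftrightarrow> p) \<and> dim H = k}"
  proof (rule bij_betwI[where g = "\<lambda>H. ({x. (x, 0) \<in> H}, {y. (0, y) \<in> H})"], goal_cases)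
    case 1
    have "0 \<in> pointed_sum F G \<longleftrightarrow> 0 \<in> F" if "{x. (x, 0) \<in> pointed_sum F G} = F" for F :: "'a set" and G :: "'b set"
      using that by (auto simp: zero_prod_def)
    then show ?case
      using pointed_sum_face[OF S T] by (auto simp: dim_pointed_sum)
  next
    case 2
    show ?case
    proof (clarify, goal_cases)
      case (1 H)
      have sub: "{x. (x, 0) \<in> H} \<subseteq> S" "{y. (0, y) \<in> H} \<subseteq> T"
        using face_of_imp_subset[OF 1(1)] pointed_sum_axes[OF conv(1) S(2) conv(2) T(2)] by auto
      note * = face_of_pointed_sum[OF conv(1) S(2) conv(2) T(2) 1(1) sub]
      have "dim H = dim {x. (x, 0) \<in> H} + dim {y. (0, y) \<in> H}"
        using *(3) dim_pointed_sum by metis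
      then show ?case using * 1 by (auto simp: zero_prod_def)
    qed
  next
    case (3 p)
    then show ?case using pointed_sum_face[OF S T] by (auto split: prod.splits)
  next
    case (4 H)
    then have H: "H face_of pointed_sum S T" by simp
    have sub: "{x. (x, 0) \<in> H} \<subseteq> S" "{y. (0, y) \<in> H} \<subseteq> T"
      using face_of_imp_subset[OF H] pointed_sum_axes[OF conv(1) S(2) conv(2) T(2)] by auto
    show ?case using face_of_pointed_sum(3)[OF conv(1) S(2) conv(2) T(2) H sub] by simp
  qed
  then have "card {H. H face_of pointed_sum S T \<and> (0 \<in> H \<longleftrightarrow> p) \<and> dim H = k} = card ?R"
    by (rule bij_betw_same_card[symmetric])
  also have "\<dots> = (\<Sum>j = 0..k. card {F \<in> ?X. dim F = j} * card {G \<in> ?Y. dim G = k - j})"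
    by (rule card_pairs_graded[OF fin])
  finally show ?thesis by (simp add: conj_assoc)
qed

lemma star_number_pointed_sum:
  assumes "polytope S" "0 \<in> S" "polytope T" "0 \<in> T"
  shows "star_number (pointed_sum S T) k = (\<Sum>j = 0..k. star_number S j * star_number T (k - j))"
  using card_faces_pointed_sum[OF assms, of True k] by (simp add: star_number_def)

lemma antistar_number_pointed_sum:
  assumes "polytope S" "0 \<in> S" "polytope T" "0 \<in> T"
  shows "antistar_number (pointed_sum S T) k = (\<Sum>j = 0..k. antistar_number S j * antistar_number T (k - j))"
  using card_faces_pointed_sum[OF assms, of False k] by (simp add: antistar_number_def)

section \<open>Generating functions\<close>

text \<open>Integer coefficients permit the subtractions in the final identity, and multiplication
  of power series is the convolution just obtained.\<close>

definition star_series :: "'v::euclidean_space set \<Rightarrow> int fps" where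
  "star_series S = Abs_fps (\<lambda>k. int (star_number S k))"

definition antistar_series :: "'v::euclidean_space set \<Rightarrow> int fps" where
  "antistar_series S = Abs_fps (\<lambda>k. int (antistar_number S k))"

lemma face_number_series:
  assumes "polytope S" "0 \<in> S"
  shows "int (face_number S (int k - 1)) = fps_nth (fps_X * star_series S + antistar_series S) k"
  by (simp add: face_number_star_antistar[OF assms] star_series_def antistar_series_def)

lemma pointed_sum_series:
  assumes "polytope S" "0 \<in> S" "polytope T" "0 \<in> T"
  shows "star_series (pointed_sum S T) = star_series S * star_series T"
    and "antistar_series (pointed_sum S T) = antistar_series S * antistar_series T"
  by (simp_all add: fps_eq_iff fps_mult_nth star_series_def antistar_series_def
      star_number_pointed_sum[OF assms] antistar_number_pointed_sum[OF assms])

definition fps_nonneg :: "int fps \<Rightarrow> bool" where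
  "fps_nonneg p \<longleftrightarrow> (\<forall>k. 0 \<le> fps_nth p k)"

lemma fps_nonneg_add: "fps_nonneg p \<Longrightarrow> fps_nonneg q \<Longrightarrow> fps_nonneg (p + q)"
  by (simp add: fps_nonneg_def)

lemma fps_nonneg_mult: "fps_nonneg p \<Longrightarrow> fps_nonneg q \<Longrightarrow> fps_nonneg (p * q)"
  by (auto simp: fps_nonneg_def fps_mult_nth intro!: sum_nonneg mult_nonneg_nonneg)

text \<open>In the application \<open>S'\<close> and \<open>T'\<close> are chain polytopes: they
  have at least as many faces in each dimension, but at most as many through the origin.\<close>

lemma face_number_pointed_sum_le:
  fixes S S' :: "'a::euclidean_space set" and T T' :: "'b::euclidean_space set"
  assumes S: "polytope S" "0 \<in> S" and S': "polytope S'" "0 \<in> S'"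
    and T: "polytope T" "0 \<in> T" and T': "polytope T'" "0 \<in> T'"
    and fS: "\<And>k. face_number S (int k - 1) \<le> face_number S' (int k - 1)"
    and fT: "\<And>k. face_number T (int k - 1) \<le> face_number T' (int k - 1)"
    and sS: "\<And>k. star_number S' k \<le> star_number S k"
    and sT: "\<And>k. star_number T' k \<le> star_number T k"
  shows "face_number (pointed_sum S T) (int k - 1) \<le> face_number (pointed_sum S' T') (int k - 1)"
proof -
  \<comment> \<open>Roman letters belong to \<open>S\<close> and \<open>T\<close>, Greek ones to
    \<open>S'\<close> and \<open>T'\<close>; a prime on a letter marks the second summand.\<close>
  define a b where "a = star_series S" and "b = antistar_series S"
  define \<alpha> \<beta> where "\<alpha> = star_series S'" and "\<beta> = antistar_series S'"
  define a' b' where "a' = star_series T" and "b' = antistar_series T"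
  define \<alpha>' \<beta>' where "\<alpha>' = star_series T'" and "\<beta>' = antistar_series T'"
  note defs = a_def b_def \<alpha>_def \<beta>_def a'_def b'_def \<alpha>'_def \<beta>'_def
  have f: "fps_nonneg ((fps_X * \<alpha> + \<beta>) - (fps_X * a + b))"
    "fps_nonneg ((fps_X * \<alpha>' + \<beta>') - (fps_X * a' + b'))"
    using fS fT unfolding fps_nonneg_def defs fps_sub_nth
      face_number_series[OF S, symmetric] face_number_series[OF S', symmetric]
      face_number_series[OF T, symmetric] face_number_series[OF T', symmetric] by simp_all
  have s: "fps_nonneg (a - \<alpha>)" "fps_nonneg (a' - \<alpha>')"
    using sS sT by (simp_all add: fps_nonneg_def defs star_series_def)
  \<comment> \<open>Each mixed product in the identity calls for one comparison of star and
    antistar: for \<open>T\<close> and for \<open>S'\<close>.\<close>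
  have t: "fps_nonneg (b' - a')" "fps_nonneg (\<beta> - \<alpha>)"
    using star_le_antistar[OF T] star_le_antistar[OF S']
    by (simp_all add: fps_nonneg_def defs star_series_def antistar_series_def)
  have p: "fps_nonneg b'" "fps_nonneg \<beta>" "fps_nonneg fps_X"
    by (simp_all add: fps_nonneg_def defs antistar_series_def)
  have "(fps_X * (\<alpha> * \<alpha>') + \<beta> * \<beta>') - (fps_X * (a * a') + b * b') =
      fps_X * (a - \<alpha>) * (b' - a') + ((fps_X * \<alpha> + \<beta>) - (fps_X * a + b)) * b'
      + fps_X * (a' - \<alpha>') * (\<beta> - \<alpha>) + \<beta> * ((fps_X * \<alpha>' + \<beta>') - (fps_X * a' + b'))"
    by (simp add: algebra_simps)
  moreover have "fps_nonneg \<dots>"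
    using f s t p by (intro fps_nonneg_add fps_nonneg_mult)
  ultimately have "fps_nonneg ((fps_X * (\<alpha> * \<alpha>') + \<beta> * \<beta>') - (fps_X * (a * a') + b * b'))"
    by simp
  moreover have "fps_X * (\<alpha> * \<alpha>') + \<beta> * \<beta>' =
      fps_X * star_series (pointed_sum S' T') + antistar_series (pointed_sum S' T')"
    "fps_X * (a * a') + b * b' = fps_X * star_series (pointed_sum S T) + antistar_series (pointed_sum S T)"
    unfolding defs using pointed_sum_series[OF S T] pointed_sum_series[OF S' T'] by simp_all
  moreover have "polytope (pointed_sum S T)" "0 \<in> pointed_sum S T"
      "polytope (pointed_sum S' T')" "0 \<in> pointed_sum S' T'"
    using polytope_pointed_sum pointed_sum_left[of 0] assms(1-8) by (auto simp: zero_prod_def)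
  ultimately have "int (face_number (pointed_sum S T) (int k - 1)) \<le> int (face_number (pointed_sum S' T') (int k - 1))"
    by (simp add: face_number_series fps_nonneg_def del: fps_add_nth fps_mult_fps_X_commute)
  then show ?thesis by simp
qed

section \<open>Order polytopes and chain polytopes\<close>

lemma partial_order_onD:
  assumes "partial_order_on A r"
  shows "r \<subseteq> A \<times> A" "\<And>x. x \<in> A \<Longrightarrow> (x, x) \<in> r"
    "\<And>x y z. (x, y) \<in> r \<Longrightarrow> (y, z) \<in> r \<Longrightarrow> (x, z) \<in> r"
    "\<And>x y. (x, y) \<in> r \<Longrightarrow> (y, x) \<in> r \<Longrightarrow> x = y"
  using assms unfolding partial_order_on_def preorder_on_def refl_on_def trans_def antisym_def
  by blast+

lemma dim_eq_card_coordinates: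
  fixes S :: "(real ^ 'a::finite) set"
  assumes "\<And>x i. x \<in> S \<Longrightarrow> i \<notin> I \<Longrightarrow> x $ i = 0"
    and "\<And>i. i \<in> I \<Longrightarrow> axis i 1 \<in> span S"
  shows "dim S = card I"
proof -
  let ?V = "{x :: real ^ 'a. \<forall>i. i \<notin> I \<longrightarrow> x $ i = 0}"
  have "x \<in> span S" if x: "x \<in> ?V" for x
  proof -
    have "x = (\<Sum>i\<in>I. x $ i *\<^sub>R axis i 1)"
    proof (rule vec_eq_iff[THEN iffD2], rule allI)
      fix j
      have "(\<Sum>i\<in>I. x $ i *\<^sub>R axis i 1) $ j = (\<Sum>i\<in>I. if i = j then x $ i else 0)"
        unfolding sum_component by (rule sum.cong) (auto simp: axis_def)
      also have "\<dots> = x $ j" using x by (simp add: sum.delta)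
      finally show "x $ j = (\<Sum>i\<in>I. x $ i *\<^sub>R axis i 1) $ j" by simp
    qed
    also have "\<dots> \<in> span S" by (intro span_sum span_scale assms(2))
    finally show ?thesis .
  qed
  then have "?V \<subseteq> span S" by blast
  moreover have "S \<subseteq> ?V" using assms(1) by auto
  ultimately have "dim S = dim ?V"
    using dim_subset[of S ?V] dim_subset[of ?V "span S"] by (simp add: dim_span)
  then show ?thesis using dim_substandard_cart[of I, where ?'a = real] by (simp add: dim_vec_eq)
qed

lemma zero_in_order_polytope: "0 \<in> order_polytope A r"
  by (simp add: order_polytope_def)

lemma zero_in_chain_polytope: "0 \<in> chain_polytope A r"
  by (simp add: chain_polytope_def)

text \<open>All coordinates are nonnegative on the polytope, so a combination with positive weights
  vanishes only if both points do.\<close>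

lemma zero_face_of_order_polytope: "{0} face_of order_polytope A r"
proof -
  have "a = 0 \<and> b = 0"
    if ab: "a \<in> order_polytope A r" "b \<in> order_polytope A r" "0 \<in> open_segment a b" for a b
  proof -
    obtain u where u: "0 < u" "u < 1" "0 = (1 - u) *\<^sub>R a + u *\<^sub>R b"
      using ab(3) by (auto simp: in_segment)
    have nn: "0 \<le> a $ i" "0 \<le> b $ i" for i
      using ab by (cases "i \<in> A"; auto simp: order_polytope_def)+
    have "(1 - u) * a $ i + u * b $ i = 0" for i
      using u(3) by (metis vector_add_component vector_scaleR_component zero_index real_scaleR_def)
    then have "(1 - u) * a $ i = 0 \<and> u * b $ i = 0" for i
      using nn[of i] u(1,2) add_nonneg_eq_0_iff[of "(1 - u) * a $ i" "u * b $ i"] by simp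
    then have "a $ i = 0 \<and> b $ i = 0" for i
      using u(1,2) by (metis diff_gt_0_iff_gt less_irrefl mult_eq_0_iff)
    then show ?thesis by (simp add: vec_eq_iff)
  qed
  then show ?thesis by (simp add: face_of_def zero_in_order_polytope)
qed

lemma dim_order_polytope:
  assumes "partial_order_on A r"
  shows "dim (order_polytope A r) = card A"
proof (rule dim_eq_card_coordinates)
  note r = partial_order_onD[OF assms]
  fix i assume i: "i \<in> A"
  \<comment> \<open>The indicators of the up-set generated by \<open>i\<close> and of the same
    up-set without \<open>i\<close>; they differ by the axis vector of \<open>i\<close>.\<close>
  let ?x = "\<chi> j. if (i, j) \<in> r then 1 else (0 :: real)"
  let ?y = "\<chi> j. if (i, j) \<in> r \<and> i \<noteq> j then 1 else (0 :: real)"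
  have "?x \<in> order_polytope A r" "?y \<in> order_polytope A r"
    unfolding order_polytope_def using r by auto
  then have "?x - ?y \<in> span (order_polytope A r)" by (intro span_diff span_base)
  moreover have "?x - ?y = axis i 1" using r(2)[OF i] by (auto simp: vec_eq_iff axis_def)
  ultimately show "axis i 1 \<in> span (order_polytope A r)" by simp
qed (simp add: order_polytope_def)

lemma star_number_order_polytope_ge:
  assumes "partial_order_on A r"
  shows "card A choose k \<le> star_number (order_polytope A r) k"
  using star_number_ge[OF polytope_order_polytope zero_face_of_order_polytope, of A r k]
  by (simp add: dim_order_polytope[OF assms])

lemma chain_polytope_downward:
  assumes "x \<in> chain_polytope A r" "\<And>i. 0 \<le> y $ i" "\<And>i. y $ i \<le> x $ i"
  shows "y \<in> chain_polytope A r"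
proof -
  have "y $ i = 0" if "i \<notin> A" for i
  proof -
    have "x $ i = 0" using assms(1) that by (simp add: chain_polytope_def)
    then show ?thesis using assms(2,3)[of i] by simp
  qed
  moreover have "(\<Sum>i\<in>K. y $ i) \<le> 1" if "K \<in> Chains r" for K
  proof -
    have "(\<Sum>i\<in>K. y $ i) \<le> (\<Sum>i\<in>K. x $ i)" by (intro sum_mono assms(3))
    also have "\<dots> \<le> 1" using assms(1) that by (simp add: chain_polytope_def)
    finally show ?thesis .
  qed
  ultimately show ?thesis using assms(2) by (simp add: chain_polytope_def)
qed

lemma chain_polytope_bounds:
  assumes "partial_order_on A r" "x \<in> chain_polytope A r"
  shows "0 \<le> x $ i" "x $ i \<le> 1"
proof -
  show "0 \<le> x $ i" using assms(2) by (cases "i \<in> A") (auto simp: chain_polytope_def)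
  show "x $ i \<le> 1"
  proof (cases "i \<in> A")
    case True
    then have "{i} \<in> Chains r" using partial_order_onD(2)[OF assms(1)] by (simp add: Chains_def)
    then have "(\<Sum>j\<in>{i}. x $ j) \<le> 1" using assms(2) unfolding chain_polytope_def by blast
    then show ?thesis by simp
  qed (use assms(2) in \<open>simp add: chain_polytope_def\<close>)
qed

lemma axis_in_chain_polytope:
  assumes "i \<in> A"
  shows "axis i 1 \<in> chain_polytope A r"
proof -
  have "(\<Sum>j\<in>K. axis i 1 $ j) \<le> (1::real)" for K
    by (simp add: axis_def sum.delta)
  then show ?thesis using assms by (auto simp: chain_polytope_def axis_def)
qed

text \<open>Hence faces through the origin are determined by their supports. Some \<open>z\<close>
  in \<open>F\<close> is positive on the support of \<open>x\<close>; then \<open>z / 2\<close> lies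
  in \<open>F\<close> and is a combination, with positive weights, of \<open>x\<close> and another
  point \<open>w\<close> of the polytope, which puts \<open>x\<close> into \<open>F\<close>.\<close>

lemma chain_polytope_face_through_zero:
  fixes A :: "'a::finite set"
  assumes po: "partial_order_on A r" and F: "F face_of chain_polytope A r" "0 \<in> F"
    and x: "x \<in> chain_polytope A r" "\<And>i. x $ i \<noteq> 0 \<Longrightarrow> \<exists>w\<in>F. w $ i \<noteq> 0"
  shows "x \<in> F"
proof -
  let ?I = "{i. x $ i \<noteq> 0}"
  have FC: "F \<subseteq> chain_polytope A r" using F(1) by (rule face_of_imp_subset)
  have cF: "convex F" using F(1) by (rule face_of_imp_convex)
  note bounds = chain_polytope_bounds[OF po]
  \<comment> \<open>Averaging witnesses for single coordinates yields a point positive at all of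
    them, since no coordinate is ever negative.\<close>
  have "\<exists>z\<in>F. \<forall>i\<in>J. 0 < z $ i" if "finite J" "J \<subseteq> ?I" for J
    using that
  proof (induction J rule: finite_induct)
    case empty
    then show ?case using F(2) by auto
  next
    case (insert j J)
    then obtain z where z: "z \<in> F" "\<forall>i\<in>J. 0 < z $ i" by auto
    obtain w where w: "w \<in> F" "w $ j \<noteq> 0" using x(2) insert.prems by auto
    have nn: "0 \<le> z $ i" "0 \<le> w $ i" for i using bounds(1) FC z(1) w(1) by blast+
    have "(1 / 2) *\<^sub>R z + (1 / 2) *\<^sub>R w \<in> F"
      using convexD[OF cF z(1) w(1), of "1/2" "1/2"] by simp
    moreover have "0 < ((1 / 2) *\<^sub>R z + (1 / 2) *\<^sub>R w) $ i" if "i \<in> insert j J" for i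
      using that z(2) w(2) nn[of i] nn[of j] by (cases "i = j") (auto intro: add_nonneg_pos add_pos_nonneg simp: less_le)
    ultimately show ?case by blast
  qed
  then obtain z where z: "z \<in> F" "\<forall>i\<in>?I. 0 < z $ i" by (metis finite_code subset_refl)
  \<comment> \<open>The entry 1 keeps \<open>e\<close> at most 1/2, also for empty support; the
    other entries give \<open>e x \<le> z / 2\<close> coordinatewise, because \<open>x\<close> is
    bounded by 1.\<close>
  define e where "e = Min (insert 1 ((\<lambda>i. z $ i) ` ?I)) / 2"
  have e: "0 < e" "e \<le> 1 / 2" and ez: "\<And>i. i \<in> ?I \<Longrightarrow> e \<le> z $ i / 2"
    using z(2) by (auto simp: e_def Min_gr_iff Min_le_iff)
  \<comment> \<open>Solves \<open>z / 2 = (1 - e) w + e x\<close> for \<open>w\<close>; the bounds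
    on \<open>e\<close> give \<open>0 \<le> w \<le> z\<close>.\<close>
  define w where "w = (1 / (1 - e)) *\<^sub>R ((1 / 2) *\<^sub>R z - e *\<^sub>R x)"
  have z0: "0 \<le> z $ i" for i using bounds(1) FC z(1) by blast
  have x0: "0 \<le> x $ i" "x $ i \<le> 1" for i using bounds x(1) by blast+
  have ex: "e * x $ i \<le> z $ i / 2" for i
  proof (cases "i \<in> ?I")
    case True
    then show ?thesis using ez[OF True] mult_left_le[of "x $ i" e] x0[of i] e(1) by linarith
  qed (simp add: z0)
  have wC: "w \<in> chain_polytope A r"
  proof (rule chain_polytope_downward)
    show "z \<in> chain_polytope A r" using z FC by blast
    fix i
    show "0 \<le> w $ i" using ex[of i] e by (simp add: w_def)
    have "z $ i / 2 - e * x $ i \<le> (1 - e) * z $ i"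
      using mult_right_mono[OF e(2) z0[of i]] mult_nonneg_nonneg[OF _ x0(1)[of i], of e] e(1)
      by (simp add: algebra_simps)
    then have "(z $ i / 2 - e * x $ i) / (1 - e) \<le> z $ i"
      using e by (simp add: pos_divide_le_eq mult.commute)
    then show "w $ i \<le> z $ i" by (simp add: w_def)
  qed
  have comb: "(1 / 2) *\<^sub>R z = (1 - e) *\<^sub>R w + e *\<^sub>R x"
    using e by (simp add: w_def)
  have half: "(1 / 2) *\<^sub>R z \<in> F"
    using convexD[OF cF z(1) F(2), of "1/2" "1/2"] by simp
  show ?thesis
  proof (cases "w = x")
    case True
    then have "(1 / 2) *\<^sub>R z = x" using comb by (simp add: algebra_simps)
    then show ?thesis using half by simp
  next
    case False
    then have "(1 / 2) *\<^sub>R z \<in> open_segment w x" using comb e by (auto simp: in_segment)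
    then show ?thesis using face_ofD[OF F(1) _ wC x(1) half] by blast
  qed
qed

text \<open>A face through the origin is determined by its support and contains the axis vectors of
  that support, so its dimension is the size of the support. Such faces therefore inject into the
  \<open>k\<close>-subsets of \<open>A\<close>.\<close>

lemma star_number_chain_polytope_le:
  assumes po: "partial_order_on A r"
  shows "star_number (chain_polytope A r) k \<le> card A choose k"
proof -
  let ?C = "chain_polytope A r"
  let ?X = "{F. F face_of ?C \<and> 0 \<in> F \<and> dim F = k}"
  let ?s = "\<lambda>F :: (real ^ 'a) set. {i. \<exists>x\<in>F. x $ i \<noteq> 0}"
  have sub: "F \<subseteq> F'" if "F \<in> ?X" "F' \<in> ?X" "?s F = ?s F'" for F F'
  proof
    fix x assume x: "x \<in> F"
    have "x \<in> ?C" using that(1) x face_of_imp_subset by blast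
    moreover have "\<exists>w\<in>F'. w $ i \<noteq> 0" if "x $ i \<noteq> 0" for i
      using that x \<open>?s F = ?s F'\<close> by blast
    ultimately show "x \<in> F'"
      using that(2) chain_polytope_face_through_zero[OF po] by blast
  qed
  have "inj_on ?s ?X"
  proof (rule inj_onI)
    fix F F' assume "F \<in> ?X" "F' \<in> ?X" "?s F = ?s F'"
    then show "F = F'" using sub[of F F'] sub[of F' F] by blast
  qed
  moreover have "?s ` ?X \<subseteq> {B. B \<subseteq> A \<and> card B = k}"
  proof clarify
    fix F assume F: "F face_of ?C" "0 \<in> F" "k = dim F"
    have FC: "F \<subseteq> ?C" using F(1) by (rule face_of_imp_subset)
    have sA: "?s F \<subseteq> A" using FC by (auto simp: chain_polytope_def)
    have "dim F = card (?s F)"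
    proof (rule dim_eq_card_coordinates)
      fix i assume i: "i \<in> ?s F"
      then have "axis i 1 \<in> ?C" using sA axis_in_chain_polytope by blast
      moreover have "\<exists>w\<in>F. w $ j \<noteq> 0" if "axis i (1::real) $ j \<noteq> 0" for j
        using that i by (cases "j = i") (auto simp: axis_def)
      ultimately have "axis i 1 \<in> F"
        using chain_polytope_face_through_zero[OF po F(1,2)] by blast
      then show "axis i 1 \<in> span F" by (rule span_base)
    qed auto
    then show "?s F \<subseteq> A \<and> card (?s F) = dim F" using sA by simp
  qed
  ultimately have "star_number ?C k \<le> card {B. B \<subseteq> A \<and> card B = k}"
    unfolding star_number_def by (intro card_inj_on_le) auto
  then show ?thesis by (simp add: n_subsets)
qed

section \<open>Polytopes of disjoint unions and ordinal sums\<close>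

text \<open>The reflection \<open>1 - x\<close> on the coordinates in \<open>A\<close> reverses the
  order inequalities.\<close>

lemma face_number_order_polytope_converse:
  assumes "r \<subseteq> A \<times> A"
  shows "face_number (order_polytope A (r\<inverse>)) i = face_number (order_polytope A r) i"
proof -
  let ?f = "\<lambda>x :: real ^ 'a. \<chi> i. if i \<in> A then 1 - x $ i else 0"
  have "linear (\<lambda>x. ?f x - ?f 0)"
    by (rule linearI) (auto simp: vec_eq_iff algebra_simps)
  moreover have "?f ` order_polytope A (r\<inverse>) \<subseteq> order_polytope A r"
    "?f ` order_polytope A r \<subseteq> order_polytope A (r\<inverse>)"
    using assms by (auto simp: order_polytope_def)
  moreover have "?f (?f x) = x" if "x \<in> order_polytope A r \<or> x \<in> order_polytope A (r\<inverse>)" for x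
    using that by (auto simp: vec_eq_iff order_polytope_def)
  ultimately show ?thesis
    by (intro face_number_affine_iso[where f = ?f and g = ?f]) auto
qed

definition restrict_coords :: "'a set \<Rightarrow> real ^ 'a::finite \<Rightarrow> real ^ 'a" where
  "restrict_coords A x = (\<chi> i. if i \<in> A then x $ i else 0)"

lemma restrict_coords_nth [simp]: "restrict_coords A x $ i = (if i \<in> A then x $ i else 0)"
  by (simp add: restrict_coords_def)

text \<open>Passes from two copies of the coordinate space to a single one: for disjoint supports,
  adding vectors and splitting coordinates are mutually inverse on the given sets.\<close>

lemma face_number_split_coordinates:
  fixes P :: "(real ^ 'a::finite) set" and S :: "((real ^ 'a) \<times> (real ^ 'a)) set"
  assumes dis: "A \<inter> B = {}"
    and P: "\<And>z i. z \<in> P \<Longrightarrow> i \<notin> A \<Longrightarrow> i \<notin> B \<Longrightarrow> z $ i = 0"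
    and S: "\<And>x y i. (x, y) \<in> S \<Longrightarrow> i \<notin> A \<Longrightarrow> x $ i = 0" "\<And>x y i. (x, y) \<in> S \<Longrightarrow> i \<notin> B \<Longrightarrow> y $ i = 0"
    and SP: "\<And>x y. (x, y) \<in> S \<Longrightarrow> x + y \<in> P"
    and PS: "\<And>z. z \<in> P \<Longrightarrow> (restrict_coords A z, restrict_coords B z) \<in> S"
  shows "face_number P i = face_number S i"
proof (rule face_number_affine_iso[where g = "\<lambda>p. fst p + snd p"
      and f = "\<lambda>z. (restrict_coords A z, restrict_coords B z)"])
  show "linear (\<lambda>z. (restrict_coords A z, restrict_coords B z) - (restrict_coords A 0, restrict_coords B 0))"
    by (rule linearI) (auto simp: vec_eq_iff)
  show "linear (\<lambda>p :: (real ^ 'a) \<times> (real ^ 'a). fst p + snd p - (fst 0 + snd 0))"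
    by (rule linearI) (auto simp: algebra_simps)
  show "fst (restrict_coords A z, restrict_coords B z) + snd (restrict_coords A z, restrict_coords B z) = z"
    if "z \<in> P" for z
    using P[OF that] dis by (auto simp: vec_eq_iff)
  show "(restrict_coords A (fst p + snd p), restrict_coords B (fst p + snd p)) = p" if "p \<in> S" for p
  proof -
    obtain x y where p: "p = (x, y)" by (cases p)
    have "restrict_coords A (x + y) $ i = x $ i" for i
      using S(1)[of x y i] S(2)[of x y i] that dis p by (cases "i \<in> A") auto
    moreover have "restrict_coords B (x + y) $ i = y $ i" for i
      using S(1)[of x y i] S(2)[of x y i] that dis p by (cases "i \<in> B") auto
    ultimately show ?thesis unfolding p vec_eq_iff prod_eq_iff by simp
  qed
qed (use SP PS in auto)

lemma order_polytopeI:
  assumes "\<And>i. i \<notin> A \<Longrightarrow> x $ i = 0" "\<And>i. i \<in> A \<Longrightarrow> 0 \<le> x $ i" "\<And>i. i \<in> A \<Longrightarrow> x $ i \<le> 1"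
    and "\<And>i j. (i, j) \<in> r \<Longrightarrow> x $ i \<le> x $ j"
  shows "x \<in> order_polytope A r"
  using assms by (simp add: order_polytope_def)

lemma order_polytopeD:
  assumes "x \<in> order_polytope A r"
  shows "\<And>i. i \<notin> A \<Longrightarrow> x $ i = 0" "\<And>i. 0 \<le> x $ i" "\<And>i. x $ i \<le> 1"
    and "\<And>i j. (i, j) \<in> r \<Longrightarrow> x $ i \<le> x $ j"
proof -
  show *: "\<And>i. i \<notin> A \<Longrightarrow> x $ i = 0" "\<And>i j. (i, j) \<in> r \<Longrightarrow> x $ i \<le> x $ j"
    using assms by (simp_all add: order_polytope_def)
  show "\<And>i. 0 \<le> x $ i" "\<And>i. x $ i \<le> 1"
    using assms by (case_tac [!] "i \<in> A") (simp_all add: order_polytope_def)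
qed

lemma chain_polytopeI:
  assumes "\<And>i. i \<notin> A \<Longrightarrow> x $ i = 0" "\<And>i. i \<in> A \<Longrightarrow> 0 \<le> x $ i"
    and "\<And>K. K \<in> Chains r \<Longrightarrow> (\<Sum>i\<in>K. x $ i) \<le> 1"
  shows "x \<in> chain_polytope A r"
  using assms by (simp add: chain_polytope_def)

lemma chain_polytopeD:
  assumes "x \<in> chain_polytope A r"
  shows "\<And>i. i \<notin> A \<Longrightarrow> x $ i = 0" "\<And>i. 0 \<le> x $ i"
    and "\<And>K. K \<in> Chains r \<Longrightarrow> (\<Sum>i\<in>K. x $ i) \<le> 1"
proof -
  show *: "\<And>i. i \<notin> A \<Longrightarrow> x $ i = 0" "\<And>K. K \<in> Chains r \<Longrightarrow> (\<Sum>i\<in>K. x $ i) \<le> 1"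
    using assms by (simp_all add: chain_polytope_def)
  show "\<And>i. 0 \<le> x $ i"
    using assms by (case_tac "i \<in> A") (simp_all add: chain_polytope_def)
qed

lemma face_number_order_polytope_disjoint_union:
  fixes A :: "'a::finite set"
  assumes r: "r \<subseteq> A \<times> A" and s: "s \<subseteq> B \<times> B" and dis: "A \<inter> B = {}"
  shows "face_number (order_polytope (A \<union> B) (r \<union> s)) i =
    face_number (order_polytope A r \<times> order_polytope B s) i"
proof (rule face_number_split_coordinates[OF dis])
  fix x y assume "(x, y) \<in> order_polytope A r \<times> order_polytope B s"
  then have xy: "x \<in> order_polytope A r" "y \<in> order_polytope B s" by auto
  note x = order_polytopeD[OF xy(1)] and y = order_polytopeD[OF xy(2)]
  show "x $ i = 0" if "i \<notin> A" for i using x(1)[OF that] .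
  show "y $ i = 0" if "i \<notin> B" for i using y(1)[OF that] .
  have AB: "y $ i = 0" if "i \<in> A" for i using y(1) that dis by blast
  have BA: "x $ i = 0" if "i \<in> B" for i using x(1) that dis by blast
  show "x + y \<in> order_polytope (A \<union> B) (r \<union> s)"
  proof (rule order_polytopeI)
    fix i j assume "(i, j) \<in> r \<union> s"
    then consider "(i, j) \<in> r" "i \<in> A" "j \<in> A" | "(i, j) \<in> s" "i \<in> B" "j \<in> B" using r s by blast
    then show "(x + y) $ i \<le> (x + y) $ j"
      by cases (simp_all add: AB BA x(4) y(4))
  qed (auto simp: AB BA x y)
next
  fix z assume "z \<in> order_polytope (A \<union> B) (r \<union> s)"
  note z = order_polytopeD[OF this]
  show "z $ i = 0" if "i \<notin> A" "i \<notin> B" for i using z(1) that by blast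
  have "restrict_coords A z \<in> order_polytope A r" "restrict_coords B z \<in> order_polytope B s"
    by (rule order_polytopeI; use r s z in auto)+
  then show "(restrict_coords A z, restrict_coords B z) \<in> order_polytope A r \<times> order_polytope B s" by simp
qed

text \<open>Elements of \<open>A\<close> and \<open>B\<close> are incomparable, so a chain cannot
  meet both sets.\<close>

lemma Chains_disjoint_union:
  assumes r: "r \<subseteq> A \<times> A" and s: "s \<subseteq> B \<times> B" and dis: "A \<inter> B = {}"
  shows "Chains (r \<union> s) = Chains r \<union> Chains s"
proof (intro equalityI subsetI)
  fix K assume K: "K \<in> Chains (r \<union> s)"
  then have *: "\<And>x y. x \<in> K \<Longrightarrow> y \<in> K \<Longrightarrow> (x, y) \<in> r \<or> (y, x) \<in> r \<or> (x, y) \<in> s \<or> (y, x) \<in> s"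
    by (auto simp: Chains_def)
  show "K \<in> Chains r \<union> Chains s"
  proof (cases "K \<subseteq> A")
    case True
    then have "K \<in> Chains r" using * s dis unfolding Chains_def by blast
    then show ?thesis by blast
  next
    case False
    then have "K \<subseteq> B" using * r s dis by blast
    then have "K \<in> Chains s" using * r dis unfolding Chains_def by blast
    then show ?thesis by blast
  qed
qed (auto simp: Chains_def)

lemma Chains_subset: "r \<subseteq> A \<times> A \<Longrightarrow> K \<in> Chains r \<Longrightarrow> K \<subseteq> A"
  by (auto simp: Chains_def)

lemma sum_restrict_coords: "K \<subseteq> A \<Longrightarrow> (\<Sum>i\<in>K. restrict_coords A z $ i) = (\<Sum>i\<in>K. z $ i)"
  by (intro sum.cong) auto

lemma face_number_chain_polytope_disjoint_union:
  fixes A :: "'a::finite set"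
  assumes r: "r \<subseteq> A \<times> A" and s: "s \<subseteq> B \<times> B" and dis: "A \<inter> B = {}"
  shows "face_number (chain_polytope (A \<union> B) (r \<union> s)) i =
    face_number (chain_polytope A r \<times> chain_polytope B s) i"
proof (rule face_number_split_coordinates[OF dis])
  note ch = Chains_disjoint_union[OF assms]
  {
    fix x y assume "(x, y) \<in> chain_polytope A r \<times> chain_polytope B s"
    then have xy: "x \<in> chain_polytope A r" "y \<in> chain_polytope B s" by auto
    note x = chain_polytopeD[OF xy(1)] and y = chain_polytopeD[OF xy(2)]
    show "x $ i = 0" if "i \<notin> A" for i using x(1)[OF that] .
    show "y $ i = 0" if "i \<notin> B" for i using y(1)[OF that] .
    show "x + y \<in> chain_polytope (A \<union> B) (r \<union> s)"
    proof (rule chain_polytopeI)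
      fix K assume "K \<in> Chains (r \<union> s)"
      then consider "K \<in> Chains r" | "K \<in> Chains s" using ch by blast
      then show "(\<Sum>i\<in>K. (x + y) $ i) \<le> 1"
      proof cases
        case 1
        then have "(\<Sum>i\<in>K. y $ i) = 0"
          using Chains_subset[OF r 1] dis by (intro sum.neutral) (auto intro: y(1))
        then show ?thesis using x(3)[OF 1] by (simp add: sum.distrib)
      next
        case 2
        then have "(\<Sum>i\<in>K. x $ i) = 0"
          using Chains_subset[OF s 2] dis by (intro sum.neutral) (auto intro: x(1))
        then show ?thesis using y(3)[OF 2] by (simp add: sum.distrib)
      qed
    qed (auto simp: x y)
  next
    fix z assume "z \<in> chain_polytope (A \<union> B) (r \<union> s)"
    note z = chain_polytopeD[OF this]
    show "z $ i = 0" if "i \<notin> A" "i \<notin> B" for i using z(1) that by blast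
    have "restrict_coords A z \<in> chain_polytope A r"
    proof (rule chain_polytopeI)
      fix K assume K: "K \<in> Chains r"
      then show "(\<Sum>i\<in>K. restrict_coords A z $ i) \<le> 1"
        using z(3)[of K] ch sum_restrict_coords[OF Chains_subset[OF r K]] by simp
    qed (auto simp: z)
    moreover have "restrict_coords B z \<in> chain_polytope B s"
    proof (rule chain_polytopeI)
      fix K assume K: "K \<in> Chains s"
      then show "(\<Sum>i\<in>K. restrict_coords B z $ i) \<le> 1"
        using z(3)[of K] ch sum_restrict_coords[OF Chains_subset[OF s K]] by simp
    qed (auto simp: z)
    ultimately show "(restrict_coords A z, restrict_coords B z) \<in> chain_polytope A r \<times> chain_polytope B s" by simp
  }
qed

text \<open>Let \<open>u\<close> be the largest weight of a chain of \<open>A\<close>. A heaviest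
  chain of \<open>A\<close> together with any chain of \<open>B\<close> is a chain of the ordinal
  sum, so chains of \<open>B\<close> weigh at most \<open>1 - u\<close>; dividing by
  \<open>u\<close> and \<open>1 - u\<close> gives points of the two summands.\<close>

lemma restrict_chain_polytope_pointed_sum:
  fixes A :: "'a::finite set"
  assumes po: "partial_order_on A r" "partial_order_on B s" and A: "A \<inter> B = {}"
    and z: "z \<in> chain_polytope (A \<union> B) (ordinal_sum A r B s)"
  shows "(restrict_coords A z, restrict_coords B z) \<in> pointed_sum (chain_polytope A r) (chain_polytope B s)"
proof -
  note z = chain_polytopeD[OF z]
  note r = partial_order_onD(1)[OF po(1)] and s = partial_order_onD(1)[OF po(2)]
  have single: "{i} \<in> Chains r" if "i \<in> A" for i
    using partial_order_onD(2)[OF po(1) that] by (simp add: Chains_def)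
  have single': "{i} \<in> Chains s" if "i \<in> B" for i
    using partial_order_onD(2)[OF po(2) that] by (simp add: Chains_def)
  let ?U = "(\<lambda>K. \<Sum>i\<in>K. z $ i) ` Chains r"
  have fin: "finite (Chains r)" by simp
  have e: "{} \<in> Chains r" "{} \<in> Chains s" by (simp_all add: Chains_def)
  have un: "(\<Sum>i\<in>K. z $ i) + (\<Sum>i\<in>L. z $ i) \<le> 1" if KL: "K \<in> Chains r" "L \<in> Chains s" for K L
  proof -
    have sub: "K \<subseteq> A" "L \<subseteq> B" using Chains_subset r s KL by blast+
    have "K \<union> L \<in> Chains (ordinal_sum A r B s)"
      using KL sub unfolding Chains_def ordinal_sum_def by blast
    then have "(\<Sum>i\<in>K \<union> L. z $ i) \<le> 1" by (rule z(3))
    moreover have "K \<inter> L = {}" using sub A by blast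
    ultimately show ?thesis by (simp add: sum.union_disjoint)
  qed
  define u where "u = Max ?U"
  have ge: "(\<Sum>i\<in>K. z $ i) \<le> u" if "K \<in> Chains r" for K
    unfolding u_def using that fin by (intro Max_ge) auto
  have "u \<in> ?U" unfolding u_def using e fin by (intro Max_in) auto
  then obtain K where K: "K \<in> Chains r" "u = (\<Sum>i\<in>K. z $ i)" by blast
  have u01: "0 \<le> u" "u \<le> 1" using ge[OF e(1)] un[OF K(1) e(2)] K(2) by simp_all
  have le: "(\<Sum>i\<in>L. z $ i) \<le> 1 - u" if "L \<in> Chains s" for L using un[OF K(1) that] K(2) by simp
  \<comment> \<open>For \<open>v = 0\<close> the singleton chains force the restriction to be zero,
    so the scaled vector is the origin whatever \<open>1 / 0\<close> means.\<close>
  have scaled: "(1 / v) *\<^sub>R restrict_coords C z \<in> chain_polytope C q \<and>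
      v *\<^sub>R (1 / v) *\<^sub>R restrict_coords C z = restrict_coords C z"
    if v: "0 \<le> v" "\<And>L. L \<in> Chains q \<Longrightarrow> (\<Sum>i\<in>L. z $ i) \<le> v"
      and q: "q \<subseteq> C \<times> C" "\<And>i. i \<in> C \<Longrightarrow> {i} \<in> Chains q" for v C q
  proof (cases "v = 0")
    case True
    have "z $ i = 0" if "i \<in> C" for i
      using v(2)[OF q(2)[OF that]] z(2)[of i] True by simp
    then have "restrict_coords C z = 0" by (simp add: vec_eq_iff)
    then show ?thesis using zero_in_chain_polytope by simp
  next
    case False
    then have pos: "0 < v" using v(1) by simp
    have "(1 / v) *\<^sub>R restrict_coords C z \<in> chain_polytope C q"
    proof (rule chain_polytopeI)
      fix L assume L: "L \<in> Chains q"
      have "(\<Sum>i\<in>L. ((1 / v) *\<^sub>R restrict_coords C z) $ i) = (1 / v) * (\<Sum>i\<in>L. restrict_coords C z $ i)"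
        by (simp add: sum_distrib_left)
      also have "(\<Sum>i\<in>L. restrict_coords C z $ i) = (\<Sum>i\<in>L. z $ i)"
        by (rule sum_restrict_coords[OF Chains_subset[OF q(1) L]])
      also have "(1 / v) * (\<Sum>i\<in>L. z $ i) \<le> 1" using v(2)[OF L] pos by simp
      finally show "(\<Sum>i\<in>L. ((1 / v) *\<^sub>R restrict_coords C z) $ i) \<le> 1" .
    qed (use pos z(2) in auto)
    then show ?thesis using pos by simp
  qed
  note 1 = scaled[OF u01(1) ge r single] and 2 = scaled[OF _ le s single']
  show ?thesis
    using pointed_sum_combination[OF conjunct1[OF 1] conjunct1[OF 2] u01] conjunct2[OF 1] conjunct2[OF 2] u01
    by simp
qed

text \<open>It remains to see that the hull maps into the chain polytope: a chain of the ordinal sum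
  is cut by \<open>A\<close> and \<open>B\<close> into two chains, of weight at most
  \<open>u\<close> and \<open>1 - u\<close>.\<close>

lemma face_number_chain_polytope_ordinal_sum:
  fixes A :: "'a::finite set"
  assumes po: "partial_order_on A r" "partial_order_on B s" and dis: "A \<inter> B = {}"
  shows "face_number (chain_polytope (A \<union> B) (ordinal_sum A r B s)) i =
    face_number (pointed_sum (chain_polytope A r) (chain_polytope B s)) i"
proof (rule face_number_split_coordinates[OF dis])
  note r = partial_order_onD(1)[OF po(1)] and s = partial_order_onD(1)[OF po(2)]
  have conv: "convex (chain_polytope A r)" "convex (chain_polytope B s)"
    using polytope_chain_polytope po polytope_imp_convex by blast+
  fix p q assume "(p, q) \<in> pointed_sum (chain_polytope A r) (chain_polytope B s)"
  then obtain u x y where *: "0 \<le> u" "u \<le> 1" "x \<in> chain_polytope A r" "y \<in> chain_polytope B s"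
      "(p, q) = (u *\<^sub>R x, (1 - u) *\<^sub>R y)"
    by (rule pointed_sum_cases[OF conv(1) zero_in_chain_polytope conv(2) zero_in_chain_polytope])
  then have pq: "p = u *\<^sub>R x" "q = (1 - u) *\<^sub>R y" by simp_all
  note x = chain_polytopeD[OF *(3)] and y = chain_polytopeD[OF *(4)]
  show "p $ i = 0" if "i \<notin> A" for i using x(1)[OF that] pq by simp
  show "q $ i = 0" if "i \<notin> B" for i using y(1)[OF that] pq by simp
  show "p + q \<in> chain_polytope (A \<union> B) (ordinal_sum A r B s)"
  proof (rule chain_polytopeI)
    fix K assume K: "K \<in> Chains (ordinal_sum A r B s)"
    have "K \<inter> A \<in> Chains r" "K \<inter> B \<in> Chains s"
      using K r s dis unfolding Chains_def ordinal_sum_def by blast+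
    then have le: "(\<Sum>i\<in>K \<inter> A. x $ i) \<le> 1" "(\<Sum>i\<in>K \<inter> B. y $ i) \<le> 1" using x(3) y(3) by blast+
    have "(\<Sum>i\<in>K. x $ i) = (\<Sum>i\<in>K \<inter> A. x $ i)" "(\<Sum>i\<in>K. y $ i) = (\<Sum>i\<in>K \<inter> B. y $ i)"
      by (intro sum.mono_neutral_right; use x(1) y(1) in auto)+
    then have "(\<Sum>i\<in>K. (p + q) $ i) = u * (\<Sum>i\<in>K \<inter> A. x $ i) + (1 - u) * (\<Sum>i\<in>K \<inter> B. y $ i)"
      by (simp add: pq sum.distrib sum_distrib_left[symmetric])
    also have "\<dots> \<le> u * 1 + (1 - u) * 1"
      using le *(1,2) by (intro add_mono mult_left_mono) auto
    finally show "(\<Sum>i\<in>K. (p + q) $ i) \<le> 1" by simp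
  qed (use * x y pq in auto)
next
  fix z assume z: "z \<in> chain_polytope (A \<union> B) (ordinal_sum A r B s)"
  show "z $ i = 0" if "i \<notin> A" "i \<notin> B" for i using chain_polytopeD(1)[OF z] that by blast
  show "(restrict_coords A z, restrict_coords B z) \<in> pointed_sum (chain_polytope A r) (chain_polytope B s)"
    by (rule restrict_chain_polytope_pointed_sum[OF po dis z])
qed

lemma scaled_order_polytope:
  fixes z :: "real ^ 'a::finite"
  assumes "0 \<le> v" "\<And>i. i \<notin> A \<Longrightarrow> z $ i = 0" "\<And>i. i \<in> A \<Longrightarrow> 0 \<le> z $ i" "\<And>i. i \<in> A \<Longrightarrow> z $ i \<le> v"
    "\<And>i j. (i, j) \<in> r \<Longrightarrow> z $ i \<le> z $ j"
  shows "(1 / v) *\<^sub>R z \<in> order_polytope A r" "v *\<^sub>R (1 / v) *\<^sub>R z = z"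
proof -
  have "(1 / v) *\<^sub>R z \<in> order_polytope A r \<and> v *\<^sub>R (1 / v) *\<^sub>R z = z"
  proof (cases "v = 0")
    case True
    have "z $ i = 0" for i using assms(2-4)[of i] True by (cases "i \<in> A") auto
    then have "z = 0" by (simp add: vec_eq_iff)
    then show ?thesis using zero_in_order_polytope by simp
  next
    case False
    then have pos: "0 < v" using assms(1) by simp
    have "(1 / v) *\<^sub>R z \<in> order_polytope A r"
      by (rule order_polytopeI) (use pos assms in \<open>auto simp: divide_right_mono\<close>)
    then show ?thesis using pos by simp
  qed
  then show "(1 / v) *\<^sub>R z \<in> order_polytope A r" "v *\<^sub>R (1 / v) *\<^sub>R z = z" by blast+
qed

text \<open>On the upper summand the coordinates are reversed, so that both summands meet in the origin.\<close>

lemma face_number_order_polytope_ordinal_sum: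
  fixes A :: "'a::finite set"
  assumes r: "r \<subseteq> A \<times> A" and s: "s \<subseteq> B \<times> B" and dis: "A \<inter> B = {}"
  shows "face_number (order_polytope (A \<union> B) (ordinal_sum A r B s)) i =
    face_number (pointed_sum (order_polytope A r) (order_polytope B (s\<inverse>))) i"
proof (rule face_number_affine_iso[symmetric])
  let ?f = "\<lambda>p :: (real ^ 'a) \<times> (real ^ 'a). \<chi> i. if i \<in> B then 1 - snd p $ i else fst p $ i"
  let ?g = "\<lambda>z :: real ^ 'a. (restrict_coords A z, restrict_coords B (\<chi> i. 1 - z $ i))"
  let ?O = "order_polytope (A \<union> B) (ordinal_sum A r B s)"
  let ?J = "pointed_sum (order_polytope A r) (order_polytope B (s\<inverse>))"
  show "linear (\<lambda>p. ?f p - ?f 0)"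
    by (rule linearI) (auto simp: vec_eq_iff algebra_simps)
  show "linear (\<lambda>z. ?g z - ?g 0)"
    by (rule linearI) (auto simp: vec_eq_iff algebra_simps)
  have AB: "i \<notin> B" if "i \<in> A" for i using dis that by blast
  have conv: "convex (order_polytope A r)" "convex (order_polytope B (s\<inverse>))"
    using polytope_order_polytope polytope_imp_convex by blast+
  have J: "?f p \<in> ?O \<and> ?g (?f p) = p" if p: "p \<in> ?J" for p
  proof -
    obtain u x y where *: "0 \<le> u" "u \<le> 1" "x \<in> order_polytope A r" "y \<in> order_polytope B (s\<inverse>)"
        "p = (u *\<^sub>R x, (1 - u) *\<^sub>R y)"
      using p by (rule pointed_sum_cases[OF conv(1) zero_in_order_polytope conv(2) zero_in_order_polytope])
    note x = order_polytopeD[OF *(3)] and y = order_polytopeD[OF *(4)]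
    have ux: "0 \<le> u * x $ i" "u * x $ i \<le> u" for i
      using *(1) x(2,3)[of i] by (auto intro: mult_left_le)
    have uy: "0 \<le> (1 - u) * y $ i" "(1 - u) * y $ i \<le> 1 - u" for i
      using *(2) y(2,3)[of i] by (auto intro: mult_left_le)
    have "?f p \<in> ?O"
    proof (rule order_polytopeI)
      fix i assume "i \<notin> A \<union> B"
      then show "?f p $ i = 0" using x(1)[of i] *(5) by simp
    next
      fix i
      show "0 \<le> ?f p $ i" "?f p $ i \<le> 1" using ux[of i] uy[of i] *(1,2,5) by auto
    next
      fix i j assume "(i, j) \<in> ordinal_sum A r B s"
      then consider "(i, j) \<in> r" "i \<notin> B" "j \<notin> B" | "(i, j) \<in> s" "i \<in> B" "j \<in> B" | "i \<notin> B" "j \<in> B"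
        using r s AB unfolding ordinal_sum_def by blast
      then show "?f p $ i \<le> ?f p $ j"
      proof cases
        case 1
        then show ?thesis using mult_left_mono[OF x(4)[of i j] *(1)] *(5) by simp
      next
        case 2
        then show ?thesis using mult_left_mono[OF y(4)[of j i], of "1 - u"] *(2,5) by simp
      next
        case 3
        then show ?thesis using ux(2)[of i] uy(2)[of j] *(5) by simp
      qed
    qed
    moreover have "?g (?f p) = p"
      using x(1) y(1) AB by (auto simp: *(5) vec_eq_iff)
    ultimately show ?thesis by blast
  qed
  then show "?f ` ?J \<subseteq> ?O" "\<And>p. p \<in> ?J \<Longrightarrow> ?g (?f p) = p" by blast+
  show "?f (?g z) = z" if "z \<in> ?O" for z
    using order_polytopeD(1)[OF that] by (auto simp: vec_eq_iff)
  show "?g ` ?O \<subseteq> ?J"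
  proof clarify
    fix z assume "z \<in> ?O"
    note z = order_polytopeD[OF this]
    \<comment> \<open>Every element of \<open>A\<close> lies below every element of
      \<open>B\<close>, so \<open>u\<close> separates the values of \<open>z\<close> on
      \<open>A\<close> from those on \<open>B\<close>; the entry 0 covers an empty
      \<open>A\<close>.\<close>
    define u where "u = Max (insert 0 ((\<lambda>i. z $ i) ` A))"
    have ge: "z $ i \<le> u" if "i \<in> A" for i unfolding u_def using that by (intro Max_ge) auto
    have u0: "0 \<le> u" unfolding u_def by (intro Max_ge) auto
    have "u \<in> insert 0 ((\<lambda>i. z $ i) ` A)" unfolding u_def by (intro Max_in) auto
    then have le: "u \<le> 1" "\<And>j. j \<in> B \<Longrightarrow> u \<le> z $ j"
      using z(2,3,4) unfolding ordinal_sum_def by auto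
    have zr: "z $ i \<le> z $ j" if "(i, j) \<in> r \<union> s" for i j
      using z(4) that unfolding ordinal_sum_def by blast
    have 1: "(1 / u) *\<^sub>R restrict_coords A z \<in> order_polytope A r"
      "u *\<^sub>R (1 / u) *\<^sub>R restrict_coords A z = restrict_coords A z"
      by (rule scaled_order_polytope; use u0 ge z(2) zr r in auto)+
    have 2: "(1 / (1 - u)) *\<^sub>R restrict_coords B (\<chi> i. 1 - z $ i) \<in> order_polytope B (s\<inverse>)"
      "(1 - u) *\<^sub>R (1 / (1 - u)) *\<^sub>R restrict_coords B (\<chi> i. 1 - z $ i) = restrict_coords B (\<chi> i. 1 - z $ i)"
      by (rule scaled_order_polytope; use le z(3) zr s in auto)+
    show "?g z \<in> ?J"
      using pointed_sum_combination[OF 1(1) 2(1) u0 le(1)] unfolding 1(2) 2(2) .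
  qed
qed

text \<open>Index -1 counts only the empty face, once on each side; all other indices fall under the
  convolution formula, which is monotone in its factors.\<close>

lemma face_number_Times_le:
  fixes S S' :: "'a::euclidean_space set" and T T' :: "'b::euclidean_space set"
  assumes "polytope S" "polytope S'" "polytope T" "polytope T'"
    and S: "\<And>k. face_number S (int k - 1) \<le> face_number S' (int k - 1)"
    and T: "\<And>k. face_number T (int k - 1) \<le> face_number T' (int k - 1)"
  shows "face_number (S \<times> T) (int k - 1) \<le> face_number (S' \<times> T') (int k - 1)"
proof (cases k)
  case (Suc n)
  have "face_number S (int j) \<le> face_number S' (int j)" "face_number T (int j) \<le> face_number T' (int j)" for j
    using S[of "Suc j"] T[of "Suc j"] by simp_all
  then have "face_number (S \<times> T) (int n) \<le> face_number (S' \<times> T') (int n)"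
    unfolding face_number_Times[OF assms(1,3)] face_number_Times[OF assms(2,4)]
    by (intro sum_mono mult_mono) (simp_all del: of_nat_diff)
  then show ?thesis using Suc by simp
qed (simp add: face_number_minus_one)

section \<open>X-free posets\<close>

lemma X_order_eq:
  "X_order = Id \<union> {(Xa, Xc), (Xb, Xc), (Xc, Xd), (Xc, Xe), (Xa, Xd), (Xa, Xe), (Xb, Xd), (Xb, Xe)}"
  (is "_ = ?R")
proof
  have "p = q \<or> (p, q) \<in> ?R" if "(p, q) \<in> X_order" for p q
    using that unfolding X_order_def by (induction rule: rtrancl_induct) auto
  then show "X_order \<subseteq> ?R" by auto
  have c: "(Xa, Xc) \<in> X_order" "(Xb, Xc) \<in> X_order" "(Xc, Xd) \<in> X_order" "(Xc, Xe) \<in> X_order"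
    unfolding X_order_def by auto
  have t: "(p, q) \<in> X_order \<Longrightarrow> (q, w) \<in> X_order \<Longrightarrow> (p, w) \<in> X_order" for p q w
    unfolding X_order_def by (rule rtrancl_trans)
  have "Id \<subseteq> X_order" unfolding X_order_def by auto
  then show "?R \<subseteq> X_order" using c t[OF c(1) c(3)] t[OF c(1) c(4)] t[OF c(2) c(3)] t[OF c(2) c(4)] by auto
qed

text \<open>Two incomparable elements below \<open>c\<close> and two above it would form an X-poset
  with middle element \<open>c\<close>.\<close>

lemma X_free_chain_below_or_above:
  assumes po: "partial_order_on A r" and free: "X_free A r"
    and a: "(a, c) \<in> r" "a \<noteq> c" and b: "(b, c) \<in> r" "b \<noteq> c" and ab: "(a, b) \<notin> r" "(b, a) \<notin> r"
    and d: "(c, d) \<in> r" "d \<noteq> c" and e: "(c, e) \<in> r" "e \<noteq> c"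
  shows "(d, e) \<in> r \<or> (e, d) \<in> r"
proof (rule ccontr)
  assume de: "\<not> ?thesis"
  note r = partial_order_onD[OF po]
  have A: "a \<in> A" "b \<in> A" "c \<in> A" "d \<in> A" "e \<in> A" using r(1) a b d e by auto
  define k where "k p = (case p of Xa \<Rightarrow> a | Xb \<Rightarrow> b | Xc \<Rightarrow> c | Xd \<Rightarrow> d | Xe \<Rightarrow> e)" for p
  have up: "(a, d) \<in> r" "(a, e) \<in> r" "(b, d) \<in> r" "(b, e) \<in> r"
    using r(3) a b d e by blast+
  have dn: "(c, a) \<notin> r" "(c, b) \<notin> r" "(d, c) \<notin> r" "(e, c) \<notin> r"
    using r(4) a b d e by blast+
  then have dn': "(d, a) \<notin> r" "(d, b) \<notin> r" "(e, a) \<notin> r" "(e, b) \<notin> r"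
    using r(3) a b d e by blast+
  have iff: "(k p, k q) \<in> r \<longleftrightarrow> (p, q) \<in> X_order" for p q
    using a b d e ab de up dn dn' r(2)[OF A(1)] r(2)[OF A(2)] r(2)[OF A(3)] r(2)[OF A(4)] r(2)[OF A(5)]
    by (cases p; cases q) (simp_all add: k_def X_order_eq)
  have "inj k"
  proof (rule injI)
    fix p q assume "k p = k q"
    then have "(p, q) \<in> X_order" "(q, p) \<in> X_order" using iff[of p p] iff[of p q] iff[of q p] by (auto simp: X_order_eq)
    then show "p = q" by (auto simp: X_order_eq)
  qed
  then have bij: "bij_betw (inv k) (range k) UNIV"
    by (simp add: bij_betw_inv_into inj_on_imp_bij_betw)
  have "range k \<subseteq> A" using A by (auto simp: k_def split: X_elem.split)
  moreover have "poset_isomorphic (range k) (r \<inter> range k \<times> range k) (UNIV :: X_elem set) X_order"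
    unfolding poset_isomorphic_def
  proof (intro exI conjI ballI)
    fix x y assume "x \<in> range k" "y \<in> range k"
    then show "(x, y) \<in> r \<inter> range k \<times> range k \<longleftrightarrow> (inv k x, inv k y) \<in> X_order"
      by (auto simp: iff inv_f_f[OF \<open>inj k\<close>])
  qed (rule bij)
  ultimately show False using free unfolding X_free_def by blast
qed

section \<open>Differences along chains\<close>

definition strictly_below :: "'a rel \<Rightarrow> 'a \<Rightarrow> 'a set" where
  "strictly_below r c = {i. (i, c) \<in> r \<and> i \<noteq> c}"

text \<open>The choice picks the greatest element below \<open>c\<close>; it is meaningful only when the elements below
  \<open>c\<close> form a chain.\<close>

definition increment :: "'a rel \<Rightarrow> 'a \<Rightarrow> ('a \<Rightarrow> real) \<Rightarrow> real" where
  "increment r c h = (if strictly_below r c = {} then h c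
     else h c - h (SOME p. p \<in> strictly_below r c \<and> (\<forall>q\<in>strictly_below r c. (q, p) \<in> r)))"

lemma finite_chain_has_greatest:
  assumes "finite K" "K \<noteq> {}" "K \<in> Chains r" "trans r"
  shows "\<exists>m\<in>K. \<forall>x\<in>K. (x, m) \<in> r"
  using assms
proof (induction K rule: finite_ne_induct)
  case (singleton x)
  then show ?case by (auto simp: Chains_def)
next
  case (insert x K)
  then obtain m where m: "m \<in> K" "\<forall>y\<in>K. (y, m) \<in> r" by (auto simp: Chains_def)
  have xx: "(x, x) \<in> r" using insert.prems(1) by (auto simp: Chains_def)
  consider "(x, m) \<in> r" | "(m, x) \<in> r" using insert.prems(1) m(1) by (auto simp: Chains_def)
  then show ?case
  proof cases
    case 1
    then show ?thesis using m by auto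
  next
    case 2
    then have "\<forall>y\<in>insert x K. (y, x) \<in> r" using m xx insert.prems(2) unfolding trans_def by blast
    then show ?thesis by blast
  qed
qed

text \<open>Turns the choice into a recursion: either \<open>c\<close> is minimal, or there is a
  greatest element \<open>p\<close> below \<open>c\<close>, and the principal ideal of
  \<open>c\<close> is that of \<open>p\<close> with \<open>c\<close> added.\<close>

lemma increment_cases:
  fixes r :: "'a::finite rel"
  assumes po: "partial_order_on A r" and c: "c \<in> A" and ch: "strictly_below r c \<in> Chains r"
  obtains "{i. (i, c) \<in> r} = {c}" "\<And>h. increment r c h = h c"
  | p where "(p, c) \<in> r" "p \<noteq> c" "{i. (i, c) \<in> r} = insert c {i. (i, p) \<in> r}" "(c, p) \<notin> r"
      "\<And>h. increment r c h = h c - h p"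
proof (cases "strictly_below r c = {}")
  case True
  then show ?thesis using that(1) partial_order_onD(2)[OF po c] by (auto simp: strictly_below_def increment_def)
next
  case False
  note r = partial_order_onD[OF po]
  define p where "p = (SOME p. p \<in> strictly_below r c \<and> (\<forall>q\<in>strictly_below r c. (q, p) \<in> r))"
  have "trans r" using r(3) by (rule transI)
  then have "\<exists>p. p \<in> strictly_below r c \<and> (\<forall>q\<in>strictly_below r c. (q, p) \<in> r)"
    using finite_chain_has_greatest[OF _ False ch] by auto
  then have p: "p \<in> strictly_below r c" "\<forall>q\<in>strictly_below r c. (q, p) \<in> r"
    using someI_ex[of "\<lambda>p. p \<in> strictly_below r c \<and> (\<forall>q\<in>strictly_below r c. (q, p) \<in> r)"]
    unfolding p_def by blast+
  show ?thesis
  proof (rule that(2))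
    show "(p, c) \<in> r" "p \<noteq> c" using p(1) by (auto simp: strictly_below_def)
    then show "(c, p) \<notin> r" using r(4) by blast
    show "{i. (i, c) \<in> r} = insert c {i. (i, p) \<in> r}"
      using p r(2)[OF c] r(3) by (auto simp: strictly_below_def)
    show "increment r c h = h c - h p" for h using False by (simp add: increment_def p_def)
  qed
qed

lemma sum_below_step:
  fixes r :: "'a::finite rel" and g :: "'a \<Rightarrow> real"
  assumes "{i. (i, c) \<in> r} = insert c {i. (i, p) \<in> r}" "(c, p) \<notin> r"
  shows "(\<Sum>i | (i, c) \<in> r. g i) = g c + (\<Sum>i | (i, p) \<in> r. g i)"
  using assms by simp

lemma strictly_below_chain_downward:
  assumes po: "partial_order_on A r" and ch: "strictly_below r c \<in> Chains r" and i: "(i, c) \<in> r"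
  shows "strictly_below r i \<in> Chains r"
proof -
  note r = partial_order_onD[OF po]
  have "strictly_below r i \<subseteq> strictly_below r c"
    using r(3,4) i unfolding strictly_below_def by blast
  then show ?thesis using ch unfolding Chains_def by blast
qed

text \<open>Telescoping along the chain below \<open>c\<close>, by induction on the size of the
  principal ideal.\<close>

lemma sum_increments:
  fixes r :: "'a::finite rel"
  assumes po: "partial_order_on A r" and "c \<in> A" and "strictly_below r c \<in> Chains r"
  shows "(\<Sum>i | (i, c) \<in> r. increment r i h) = h c"
  using assms(2,3)
proof (induction "card {i. (i, c) \<in> r}" arbitrary: c rule: less_induct)
  case less
  show ?case
  proof (rule increment_cases[OF po less.prems])
    assume 1: "{i. (i, c) \<in> r} = {c}" "\<And>h. increment r c h = h c"
    show ?thesis unfolding 1(1) by (simp add: 1(2))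
  next
    fix p assume p: "(p, c) \<in> r" "p \<noteq> c" "{i. (i, c) \<in> r} = insert c {i. (i, p) \<in> r}" "(c, p) \<notin> r"
      "\<And>h. increment r c h = h c - h p"
    have "card {i. (i, p) \<in> r} < card {i. (i, c) \<in> r}" using p(3,4) by simp
    moreover have "p \<in> A" using p(1) partial_order_onD(1)[OF po] by blast
    moreover have "strictly_below r p \<in> Chains r"
      by (rule strictly_below_chain_downward[OF po less.prems(2) p(1)])
    ultimately have "(\<Sum>i | (i, p) \<in> r. increment r i h) = h p" by (rule less.hyps)
    then show ?thesis using sum_below_step[OF p(3,4)] p(5)[of h] by simp
  qed
qed

text \<open>The opposite composition: the increment of partial sums is the last summand.\<close>

lemma increment_sum:
  fixes r :: "'a::finite rel"
  assumes po: "partial_order_on A r" and c: "c \<in> A" "strictly_below r c \<in> Chains r"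
    and h: "\<And>i. (i, c) \<in> r \<Longrightarrow> h i = (\<Sum>j | (j, i) \<in> r. y j)"
  shows "increment r c h = y c"
proof (rule increment_cases[OF po c])
  assume 1: "{i. (i, c) \<in> r} = {c}" "\<And>h. increment r c h = h c"
  then show ?thesis using h[of c] by auto
next
  fix p assume p: "(p, c) \<in> r" "p \<noteq> c" "{i. (i, c) \<in> r} = insert c {i. (i, p) \<in> r}" "(c, p) \<notin> r"
    "\<And>h. increment r c h = h c - h p"
  have "h c = (\<Sum>j | (j, c) \<in> r. y j)" "h p = (\<Sum>j | (j, p) \<in> r. y j)"
    using h[OF p(1)] h[OF partial_order_onD(2)[OF po c(1)]] by auto
  then show ?thesis using sum_below_step[OF p(3,4), of y] p(5)[of h] by simp
qed

lemma increment_nonneg: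
  fixes r :: "'a::finite rel"
  assumes po: "partial_order_on A r" and c: "c \<in> A" "strictly_below r c \<in> Chains r"
    and h: "\<And>i j. (i, j) \<in> r \<Longrightarrow> h i \<le> h j" "0 \<le> h c"
  shows "0 \<le> increment r c h"
  by (rule increment_cases[OF po c]) (use h in auto)

lemma principal_ideal_chain:
  assumes po: "partial_order_on A r" and c: "c \<in> A" and ch: "strictly_below r c \<in> Chains r"
  shows "{i. (i, c) \<in> r} \<in> Chains r"
  using partial_order_onD(2)[OF po c] ch unfolding Chains_def strictly_below_def by blast

text \<open>If \<open>m\<close> is the greatest element of \<open>K\<close>, then \<open>K\<close>
  lies in the principal ideal of \<open>m\<close>; the additional increments are nonnegative and the
  full sum telescopes to \<open>h m\<close>.\<close>

lemma chain_increments_le: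
  fixes r :: "'a::finite rel"
  assumes po: "partial_order_on A r" and K: "K \<in> Chains r" "K \<noteq> {}"
    and ch: "\<And>c. c \<in> K \<Longrightarrow> strictly_below r c \<in> Chains r"
    and h: "\<And>i j. (i, j) \<in> r \<Longrightarrow> h i \<le> h j" "\<And>i. i \<in> A \<Longrightarrow> 0 \<le> h i"
  shows "\<exists>m\<in>K. (\<Sum>i\<in>K. increment r i h) \<le> h m"
proof -
  note r = partial_order_onD[OF po]
  have "trans r" using r(3) by (rule transI)
  then obtain m where m: "m \<in> K" "\<forall>x\<in>K. (x, m) \<in> r"
    using finite_chain_has_greatest[OF _ K(2,1)] by auto
  have mA: "m \<in> A" using m r(1) by blast
  have "(\<Sum>i\<in>K. increment r i h) \<le> (\<Sum>i | (i, m) \<in> r. increment r i h)"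
  proof (rule sum_mono2)
    fix i assume "i \<in> {i. (i, m) \<in> r} - K"
    then have i: "(i, m) \<in> r" by simp
    then have "i \<in> A" using r(1) by blast
    then show "0 \<le> increment r i h"
      using increment_nonneg[OF po _ strictly_below_chain_downward[OF po ch[OF m(1)] i]] h by blast
  qed (use m in auto)
  also have "\<dots> = h m" by (rule sum_increments[OF po mA ch[OF m(1)]])
  finally show ?thesis using m(1) by blast
qed

lemma Chains_converse: "Chains (r\<inverse>) = Chains r"
  by (auto simp: Chains_def)

text \<open>\<open>D\<close>, the elements with a chain below them, is a down-set; by X-freeness the
  elements of the complementary up-set \<open>U\<close> have a chain above them. Differences of
  \<open>x\<close> are taken downward on \<open>D\<close>, those of \<open>1 - x\<close> upward on
  \<open>U\<close>.\<close>

lemma face_number_X_free: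
  fixes A :: "'a::finite set"
  assumes po: "partial_order_on A r" and free: "X_free A r"
  shows "face_number (order_polytope A r) i = face_number (chain_polytope A r) i"
proof -
  note r = partial_order_onD[OF po]
  note po' = partial_order_on_converse[THEN iffD2, OF po]
  define D where "D = {c \<in> A. strictly_below r c \<in> Chains r}"
  define U where "U = A - D"
  have D: "c \<in> A" "strictly_below r c \<in> Chains r" if "c \<in> D" for c using that by (auto simp: D_def)
  have UA: "c \<in> A" "c \<notin> D" if "c \<in> U" for c using that by (auto simp: U_def)
  have U: "strictly_below (r\<inverse>) c \<in> Chains (r\<inverse>)" if "c \<in> U" for c
  proof -
    have "strictly_below r c \<notin> Chains r" using that by (auto simp: U_def D_def)
    then obtain a b where "a \<in> strictly_below r c" "b \<in> strictly_below r c" "(a, b) \<notin> r" "(b, a) \<notin> r"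
      by (auto simp: Chains_def)
    then show ?thesis
      using X_free_chain_below_or_above[OF po free, of a c b] by (auto simp: strictly_below_def Chains_def)
  qed
  have down: "i \<in> D" if "(i, c) \<in> r" "c \<in> D" for i c
    using strictly_below_chain_downward[OF po D(2)[OF that(2)] that(1)] r(1) that by (auto simp: D_def)
  have up: "i \<in> U" if "(c, i) \<in> r" "c \<in> U" for i c
    using down[of c i] that r(1) by (auto simp: U_def)
  have split: "c \<in> D \<or> c \<in> U" if "c \<in> A" for c using that by (auto simp: U_def)
  let ?f = "\<lambda>x :: real ^ 'a. \<chi> c. if c \<in> D then increment r c (\<lambda>i. x $ i)
    else if c \<in> U then increment (r\<inverse>) c (\<lambda>i. 1 - x $ i) else 0"
  let ?g = "\<lambda>y :: real ^ 'a. \<chi> c. if c \<in> D then \<Sum>i | (i, c) \<in> r. y $ i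
    else if c \<in> U then 1 - (\<Sum>i | (i, c) \<in> r\<inverse>. y $ i) else 0"
  let ?O = "order_polytope A r" and ?C = "chain_polytope A r"
  show ?thesis
  proof (rule face_number_affine_iso[where f = ?f and g = ?g])
    \<comment> \<open>The element chosen in \<open>increment\<close> depends on the order and on
      \<open>c\<close> only, not on the vector, so the map is affine.\<close>
    show "linear (\<lambda>x. ?f x - ?f 0)"
      by (rule linearI) (auto simp: vec_eq_iff increment_def algebra_simps)
    show "linear (\<lambda>x. ?g x - ?g 0)"
      by (rule linearI) (auto simp: vec_eq_iff sum.distrib sum_distrib_left algebra_simps)
    show "?f ` ?O \<subseteq> ?C"
    proof clarify
      fix x assume "x \<in> ?O"
      note x = order_polytopeD[OF this]
      show "?f x \<in> ?C"
      proof (rule chain_polytopeI)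
        fix i
        show "?f x $ i = 0" if "i \<notin> A" using that by (auto simp: D_def U_def)
        show "0 \<le> ?f x $ i" if "i \<in> A"
          using increment_nonneg[OF po _ D(2), of i "\<lambda>i. x $ i"] increment_nonneg[OF po' _ U, of i "\<lambda>i. 1 - x $ i"] that x
          by auto
      next
        fix K assume K: "K \<in> Chains r"
        have KA: "K \<subseteq> A" using Chains_subset[OF r(1) K] .
        have sD: "(\<Sum>i\<in>K \<inter> D. ?f x $ i) = (\<Sum>i\<in>K \<inter> D. increment r i (\<lambda>i. x $ i))"
          by (rule sum.cong) auto
        have sU: "(\<Sum>i\<in>K \<inter> U. ?f x $ i) = (\<Sum>i\<in>K \<inter> U. increment (r\<inverse>) i (\<lambda>i. 1 - x $ i))"
          by (rule sum.cong) (auto simp: U_def)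
        have "K = (K \<inter> D) \<union> (K \<inter> U)" using KA by (auto simp: U_def)
        then have "(\<Sum>i\<in>K. ?f x $ i) = (\<Sum>i\<in>(K \<inter> D) \<union> (K \<inter> U). ?f x $ i)" by (rule arg_cong)
        also have "\<dots> = (\<Sum>i\<in>K \<inter> D. ?f x $ i) + (\<Sum>i\<in>K \<inter> U. ?f x $ i)"
          by (rule sum.union_disjoint) (auto simp: U_def)
        finally have "(\<Sum>i\<in>K. ?f x $ i) = (\<Sum>i\<in>K \<inter> D. ?f x $ i) + (\<Sum>i\<in>K \<inter> U. ?f x $ i)" .
        then have sum: "(\<Sum>i\<in>K. ?f x $ i) =
            (\<Sum>i\<in>K \<inter> D. increment r i (\<lambda>i. x $ i)) + (\<Sum>i\<in>K \<inter> U. increment (r\<inverse>) i (\<lambda>i. 1 - x $ i))"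
          unfolding sD sU .
        have KD: "K \<inter> D \<in> Chains r" and KU: "K \<inter> U \<in> Chains (r\<inverse>)"
          using K by (auto simp: Chains_def)
        have d: "\<exists>m\<in>K \<inter> D. (\<Sum>i\<in>K \<inter> D. increment r i (\<lambda>i. x $ i)) \<le> x $ m" if "K \<inter> D \<noteq> {}"
          by (rule chain_increments_le[OF po KD that]) (use D x in auto)
        have u: "\<exists>m\<in>K \<inter> U. (\<Sum>i\<in>K \<inter> U. increment (r\<inverse>) i (\<lambda>i. 1 - x $ i)) \<le> 1 - x $ m" if "K \<inter> U \<noteq> {}"
          by (rule chain_increments_le[OF po' KU that]) (use U x in auto)
        show "(\<Sum>i\<in>K. ?f x $ i) \<le> 1"
        proof (cases "K \<inter> D = {}")
          case True
          then have 0: "(\<Sum>i\<in>K \<inter> D. increment r i (\<lambda>i. x $ i)) = 0" by (simp only: sum.empty)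
          show ?thesis
          proof (cases "K \<inter> U = {}")
            case True
            then have "(\<Sum>i\<in>K \<inter> U. increment (r\<inverse>) i (\<lambda>i. 1 - x $ i)) = 0" by (simp only: sum.empty)
            then show ?thesis unfolding sum 0 by simp
          next
            case False
            then obtain m where "(\<Sum>i\<in>K \<inter> U. increment (r\<inverse>) i (\<lambda>i. 1 - x $ i)) \<le> 1 - x $ m" using u by blast
            then show ?thesis unfolding sum 0 using x(2)[of m] by linarith
          qed
        next
          case False
          then obtain m where m: "m \<in> K \<inter> D" "(\<Sum>i\<in>K \<inter> D. increment r i (\<lambda>i. x $ i)) \<le> x $ m" using d by blast
          show ?thesis
          proof (cases "K \<inter> U = {}")
            case True
            then have 0: "(\<Sum>i\<in>K \<inter> U. increment (r\<inverse>) i (\<lambda>i. 1 - x $ i)) = 0" by (simp only: sum.empty)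
            show ?thesis unfolding sum 0 using m(2) x(3)[of m] by linarith
          next
            case False
            then obtain n where n: "n \<in> K \<inter> U" "(\<Sum>i\<in>K \<inter> U. increment (r\<inverse>) i (\<lambda>i. 1 - x $ i)) \<le> 1 - x $ n"
              using u by blast
            \<comment> \<open>As \<open>D\<close> is a down-set, the chain passes upward from
              \<open>D\<close> to \<open>U\<close>, so the two bounds add up to
              \<open>x $ m + 1 - x $ n \<le> 1\<close>.\<close>
            have "(n, m) \<notin> r" using m n down UA by blast
            then have "(m, n) \<in> r" using m n K by (auto simp: Chains_def)
            then have "x $ m \<le> x $ n" by (rule x(4))
            then show ?thesis unfolding sum using m(2) n(2) by linarith
          qed
        qed
      qed
    qed
    show "?g ` ?C \<subseteq> ?O"
    proof clarify
      fix y assume "y \<in> ?C"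
      note y = chain_polytopeD[OF this]
      \<comment> \<open>The ideal of \<open>c\<close> and the filter of \<open>d\<close> are
        disjoint chains, and \<open>(c, d) \<in> r\<close> makes their union a chain; its inequality
        gives monotonicity across the boundary between \<open>D\<close> and
        \<open>U\<close>.\<close>
      have DU: "(\<Sum>i | (i, c) \<in> r. y $ i) + (\<Sum>i | (i, d) \<in> r\<inverse>. y $ i) \<le> 1"
        if cd: "c \<in> D" "d \<in> U" "(c, d) \<in> r" for c d
      proof -
        have "{i. (i, c) \<in> r} \<union> {i. (i, d) \<in> r\<inverse>} \<in> Chains r"
        proof -
          have 1: "{i. (i, c) \<in> r} \<in> Chains r" using principal_ideal_chain[OF po D] cd by blast
          have 2: "{i. (i, d) \<in> r\<inverse>} \<in> Chains r"
            using principal_ideal_chain[OF po' UA(1) U] cd by (simp add: Chains_converse)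
          have 3: "(i, j) \<in> r" if "(i, c) \<in> r" "(j, d) \<in> r\<inverse>" for i j
            using r(3)[OF r(3)[OF that(1) cd(3)]] that(2) by blast
          show ?thesis using 1 2 3 unfolding Chains_def by blast
        qed
        then have "(\<Sum>i\<in>{i. (i, c) \<in> r} \<union> {i. (i, d) \<in> r\<inverse>}. y $ i) \<le> 1" by (rule y(3))
        moreover have "{i. (i, c) \<in> r} \<inter> {i. (i, d) \<in> r\<inverse>} = {}"
          using down[OF _ cd(1)] up[OF _ cd(2)] UA(2) by blast
        ultimately show ?thesis by (simp add: sum.union_disjoint)
      qed
      have nn: "0 \<le> (\<Sum>i | (i, c) \<in> q. y $ i)" for q c by (intro sum_nonneg y(2))
      have Dle: "(\<Sum>i | (i, c) \<in> r. y $ i) \<le> 1" if "c \<in> D" for c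
        using y(3)[OF principal_ideal_chain[OF po D[OF that]]] .
      have Ule: "(\<Sum>i | (i, c) \<in> r\<inverse>. y $ i) \<le> 1" if "c \<in> U" for c
        using y(3)[of "{i. (i, c) \<in> r\<inverse>}"] principal_ideal_chain[OF po' UA(1)[OF that] U[OF that]]
        unfolding Chains_converse by blast
      have mono: "(\<Sum>i | (i, c) \<in> q. y $ i) \<le> (\<Sum>i | (i, d) \<in> q. y $ i)"
        if "(c, d) \<in> q" "\<And>x y z. (x, y) \<in> q \<Longrightarrow> (y, z) \<in> q \<Longrightarrow> (x, z) \<in> q" for c d q
        by (rule sum_mono2) (use that y(2) in auto)
      show "?g y \<in> ?O"
      proof (rule order_polytopeI)
        fix i
        show "?g y $ i = 0" if "i \<notin> A" using that by (auto simp: D_def U_def)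
        show "0 \<le> ?g y $ i" "?g y $ i \<le> 1"
          using nn[of i r] nn[of i "r\<inverse>"] Dle[of i] Ule[of i] by auto
      next
        fix c d assume cd: "(c, d) \<in> r"
        have "c \<in> A" "d \<in> A" using cd r(1) by blast+
        \<comment> \<open>The fourth combination is impossible because \<open>D\<close> is a
          down-set.\<close>
        then consider "c \<in> D" "d \<in> D" | "c \<in> U" "d \<in> U" | "c \<in> D" "d \<in> U"
          using split down[OF cd] UA(2) by blast
        then show "?g y $ c \<le> ?g y $ d"
        proof cases
          case 1
          then show ?thesis using mono[OF cd r(3)] by simp
        next
          case 2
          have "(d, c) \<in> r\<inverse>" using cd by simp
          from mono[OF this] r(3) have "(\<Sum>i | (i, d) \<in> r\<inverse>. y $ i) \<le> (\<Sum>i | (i, c) \<in> r\<inverse>. y $ i)" by blast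
          then show ?thesis using 2 UA(2) by simp
        next
          case 3
          then show ?thesis using DU[OF 3 cd] UA(2)[OF 3(2)] by simp
        qed
      qed
    qed
    fix x assume "x \<in> ?O"
    note x = order_polytopeD[OF this]
    show "?g (?f x) = x"
    proof (rule vec_eq_iff[THEN iffD2], rule allI)
      fix c
      consider "c \<in> D" | "c \<in> U" | "c \<notin> A" using split by blast
      then show "?g (?f x) $ c = x $ c"
      proof cases
        case 1
        have "(\<Sum>i | (i, c) \<in> r. ?f x $ i) = (\<Sum>i | (i, c) \<in> r. increment r i (\<lambda>i. x $ i))"
          by (rule sum.cong) (use down 1 in auto)
        then show ?thesis using sum_increments[OF po D[OF 1], of "\<lambda>i. x $ i"] 1 by simp
      next
        case 2
        have "(\<Sum>i | (i, c) \<in> r\<inverse>. ?f x $ i) = (\<Sum>i | (i, c) \<in> r\<inverse>. increment (r\<inverse>) i (\<lambda>i. 1 - x $ i))"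
          by (rule sum.cong) (use up[OF _ 2] UA(2) in auto)
        then show ?thesis using sum_increments[OF po' UA(1)[OF 2] U[OF 2], of "\<lambda>i. 1 - x $ i"] 2 UA(2)[OF 2] by simp
      next
        case 3
        then show ?thesis using x(1) D(1) UA(1) by auto
      qed
    qed
  next
    fix y assume "y \<in> ?C"
    note y = chain_polytopeD[OF this]
    show "?f (?g y) = y"
    proof (rule vec_eq_iff[THEN iffD2], rule allI)
      fix c
      consider "c \<in> D" | "c \<in> U" | "c \<notin> A" using split by blast
      then show "?f (?g y) $ c = y $ c"
      proof cases
        case 1
        have "increment r c (\<lambda>i. ?g y $ i) = y $ c"
          by (rule increment_sum[OF po D[OF 1]]) (use down 1 in auto)
        moreover have "?f z $ c = increment r c (\<lambda>i. z $ i)" for z using 1 by simp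
        ultimately show ?thesis by (rule trans[rotated])
      next
        case 2
        have "increment (r\<inverse>) c (\<lambda>i. 1 - ?g y $ i) = y $ c"
          by (rule increment_sum[OF po' UA(1)[OF 2] U[OF 2]]) (use up[OF _ 2] UA(2) in auto)
        moreover have "?f z $ c = increment (r\<inverse>) c (\<lambda>i. 1 - z $ i)" for z using 2 UA(2)[OF 2] by simp
        ultimately show ?thesis by (rule trans[rotated])
      next
        case 3
        then show ?thesis using y(1) D(1) UA(1) by auto
      qed
    qed
  qed
qed

section \<open>Induction over the family\<close>

text \<open>Stars are compared through a binomial coefficient, which bounds the star numbers of the
  chain polytope from above and those of the order polytope from below. Reversing the upper summand
  changes none of the face numbers of its order polytope.\<close>

lemma face_number_ordinal_sum_le:
  fixes A :: "'a::finite set"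
  assumes po: "partial_order_on A r" "partial_order_on B s" and dis: "A \<inter> B = {}"
    and A: "\<And>k. face_number (order_polytope A r) (int k - 1) \<le> face_number (chain_polytope A r) (int k - 1)"
    and B: "\<And>k. face_number (order_polytope B s) (int k - 1) \<le> face_number (chain_polytope B s) (int k - 1)"
  shows "face_number (order_polytope (A \<union> B) (ordinal_sum A r B s)) (int k - 1)
    \<le> face_number (chain_polytope (A \<union> B) (ordinal_sum A r B s)) (int k - 1)"
  unfolding face_number_chain_polytope_ordinal_sum[OF po dis]
    face_number_order_polytope_ordinal_sum[OF partial_order_onD(1)[OF po(1)] partial_order_onD(1)[OF po(2)] dis]
proof (rule face_number_pointed_sum_le)
  show "face_number (order_polytope B (s\<inverse>)) (int k - 1) \<le> face_number (chain_polytope B s) (int k - 1)" for k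
    using B face_number_order_polytope_converse[OF partial_order_onD(1)[OF po(2)]] by simp
  show "star_number (chain_polytope A r) k \<le> star_number (order_polytope A r) k" for k
    using star_number_chain_polytope_le[OF po(1)] star_number_order_polytope_ge[OF po(1)] order_trans by blast
  show "star_number (chain_polytope B s) k \<le> star_number (order_polytope B (s\<inverse>)) k" for k
    using star_number_chain_polytope_le[OF po(2)]
      star_number_order_polytope_ge[OF partial_order_on_converse[THEN iffD2, OF po(2)]] order_trans by blast
qed (simp_all add: A polytope_order_polytope polytope_chain_polytope po zero_in_order_polytope zero_in_chain_polytope)

lemma face_number_disjoint_union_le:
  fixes A :: "'a::finite set"
  assumes po: "partial_order_on A r" "partial_order_on B s" and dis: "A \<inter> B = {}"
    and A: "\<And>k. face_number (order_polytope A r) (int k - 1) \<le> face_number (chain_polytope A r) (int k - 1)"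
    and B: "\<And>k. face_number (order_polytope B s) (int k - 1) \<le> face_number (chain_polytope B s) (int k - 1)"
  shows "face_number (order_polytope (A \<union> B) (r \<union> s)) (int k - 1)
    \<le> face_number (chain_polytope (A \<union> B) (r \<union> s)) (int k - 1)"
  unfolding
    face_number_chain_polytope_disjoint_union[OF partial_order_onD(1)[OF po(1)] partial_order_onD(1)[OF po(2)] dis]
    face_number_order_polytope_disjoint_union[OF partial_order_onD(1)[OF po(1)] partial_order_onD(1)[OF po(2)] dis]
  by (rule face_number_Times_le) (simp_all add: A B polytope_order_polytope polytope_chain_polytope po)

lemma X_family_face_number_le:
  fixes A :: "'a::finite set"
  assumes "X_family A r"
  shows "face_number (order_polytope A r) (int k - 1) \<le> face_number (chain_polytope A r) (int k - 1)"
  using assms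
\<comment> \<open>The convolutions at index \<open>k\<close> draw on the hypotheses at other
  indices, so \<open>k\<close> is kept arbitrary.\<close>
proof (induction arbitrary: k rule: X_family.induct)
  case (X_free A r)
  then show ?case by (simp add: face_number_X_free)
next
  case (ordinal_sum A r B s)
  then show ?case using X_family_poset by (intro face_number_ordinal_sum_le) blast+
next
  case (disjoint_union A r B s)
  then show ?case using X_family_poset by (intro face_number_disjoint_union_le) blast+
qed

theorem theorem6p2:
  fixes A :: "'a::finite set" and r :: "'a rel"
  assumes "X_family A r"
  shows "coeffwise_le (f_polynomial (order_polytope A r)) (f_polynomial (chain_polytope A r))"
  by (simp add: coeffwise_le_def coeff_f_polynomial X_family_face_number_le[OF assms])

end
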